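(* Let $0<\delta<1/2$, let $\mathcal{K}$ be a compact subset of $\mathcal{S}_\delta$, and let $\tilde Q\times\tilde I$ be a box in $\mathbb{R}^{n+1}$. Then, given any $\epsilon>0$, there exists $\rho_0>0$ such that for each box $Q\times I\subset\tilde Q\times\tilde I$, each point $(p,\beta)\in\mathcal{K}$, and every sufficiently small number $\rho>0$, there exists a function $\omega=(\varphi,\psi)\in C_c^\infty(Q\times I;\mathbb{R}^{1+n})$ satisfying the following properties: (a) $\operatorname{div}\psi=0$ in $Q\times I$; (b) $(p'+D\varphi(z),\beta'+\psi_t(z))\in\mathcal{S}_\delta$ for all $z\in Q\times I$ and all $(p',\beta')\in\mathbb{R}^{n+n}$ with $|(p',\beta')-(p,\beta)|\le\rho_0$; (c) $\|\omega\|_{L^\infty(Q\times I)}<\rho$; (d) $\int_{Q\times I}|\beta+\psi_t(z)-\sigma(p+D\varphi(z))|\,dz<\epsilon\,|Q\times I|/|\tilde Q\times\tilde I|$; (e) $\int_Q\varphi(x,t)\,dx=0$ for all $t\in I$; (f) $\|\varphi_t\|_{L^\infty(Q\times I)}<\rho$.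
   Context: $\sigma(p)=\frac{p}{1+|p|^2}$ for $p\in\mathbb{R}^n$. For $0\le\delta\le1/2$, $$\mathcal{S}_\delta=\{(p,\beta)\in\mathbb{R}^{n+n}\ |\ \delta\,|(1-p\cdot\beta)p-\beta|+|\beta|^2+(p\cdot\beta)^2-p\cdot\beta<0\}.$$ A box in $\mathbb{R}^n$ is a product $Q=J_1\times\cdots\times J_n$ of finite open intervals; a box in $\mathbb{R}^{n+1}$ is written $Q\times I$ with $Q$ a box in $\mathbb{R}^n$ and $I$ a finite open interval. Points of $\mathbb{R}^{n+1}$ are $z=(x,t)$, $x\in\mathbb{R}^n$, $t\in\mathbb{R}$; $\varphi$ is scalar and $\psi$ is $\mathbb{R}^n$-valued; $D$ and $\operatorname{div}$ are with respect to $x$ and subscript $t$ denotes the derivative in $t$. $|E|$ denotes Lebesgue measure of a set $E$. The smallness threshold for $\rho$ may depend on all the other data, including $Q\times I$ and $(p,\beta)$, but $\rho_0$ does not depend on $Q\times I$, $(p,\beta)$ or $\rho$. *)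

theory Defs
  imports "HOL-Analysis.Analysis" "HOL-Probability.Essential_Supremum"
begin

definition flux :: "real ^ 'n \<Rightarrow> real ^ 'n" where
  "flux p = (1 / (1 + (norm p)\<^sup>2)) *\<^sub>R p"

definition S_set :: "real \<Rightarrow> ((real ^ 'n) \<times> (real ^ 'n)) set" where
  "S_set \<delta> = {(p, \<beta>).
     \<delta> * norm ((1 - p \<bullet> \<beta>) *\<^sub>R p - \<beta>) + (norm \<beta>)\<^sup>2 + (p \<bullet> \<beta>)\<^sup>2 - p \<bullet> \<beta> < 0}"

text \<open>Nonempty finite open boxes. For \<^typ>\<open>real\<close> these are the nonempty finite open intervals,
  and a box in space-time is a product of two such sets.\<close>

definition open_box :: "'a::euclidean_space set \<Rightarrow> bool" where
  "open_box Q \<longleftrightarrow> (\<exists>a b. Q = box a b \<and> Q \<noteq> {})"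

text \<open>On a finite-dimensional domain this is the usual class \<open>C\<^sup>k\<close> of maps on the whole space:
  the directional derivatives of a \<open>C\<^sup>k\<^sup>+\<^sup>1\<close> map are required to be \<open>C\<^sup>k\<close>.\<close>

primrec Ck :: "nat \<Rightarrow> ('a::euclidean_space \<Rightarrow> 'b::real_normed_vector) \<Rightarrow> bool" where
  "Ck 0 f \<longleftrightarrow> continuous_on UNIV f"
| "Ck (Suc k) f \<longleftrightarrow>
     (\<exists>f'. (\<forall>x. (f has_derivative f' x) (at x)) \<and> (\<forall>v. Ck k (\<lambda>x. f' x v)))"

text \<open>An element of \<open>C\<^sub>c\<^sup>\<infinity>(\<Omega>)\<close> is represented by its extension by zero to the whole space.\<close>

definition Cc_infty :: "'a::euclidean_space set \<Rightarrow> ('a \<Rightarrow> 'b::real_normed_vector) set" where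
  "Cc_infty \<Omega> = {f. (\<forall>k. Ck k f) \<and> compact (closure {z. f z \<noteq> 0}) \<and> closure {z. f z \<noteq> 0} \<subseteq> \<Omega>}"

definition partial_x :: "((real ^ 'n) \<times> real \<Rightarrow> 'b::real_normed_vector) \<Rightarrow> 'n
    \<Rightarrow> (real ^ 'n) \<times> real \<Rightarrow> 'b" where
  "partial_x f i z = frechet_derivative (\<lambda>x. f (x, snd z)) (at (fst z)) (axis i 1)"

definition grad_x :: "((real ^ 'n) \<times> real \<Rightarrow> real) \<Rightarrow> (real ^ 'n) \<times> real \<Rightarrow> real ^ 'n" where
  "grad_x f z = (\<chi> i. partial_x f i z)"

definition div_x :: "((real ^ 'n) \<times> real \<Rightarrow> real ^ 'n) \<Rightarrow> (real ^ 'n) \<times> real \<Rightarrow> real" where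
  "div_x f z = (\<Sum>i\<in>UNIV. partial_x f i z $ i)"

definition deriv_t :: "((real ^ 'n) \<times> real \<Rightarrow> 'b::real_normed_vector)
    \<Rightarrow> (real ^ 'n) \<times> real \<Rightarrow> 'b" where
  "deriv_t f z = vector_derivative (\<lambda>t. f (fst z, t)) (at (snd z))"

definition Linf_norm :: "'a::euclidean_space set \<Rightarrow> ('a \<Rightarrow> 'b::real_normed_vector) \<Rightarrow> ereal" where
  "Linf_norm E f = esssup (restrict_space lborel E) (\<lambda>z. ereal (norm (f z)))"

end

theory Submission
  imports Defs "HOL-Computational_Algebra.Polynomial" "HOL-Library.Periodic_Fun"
begin

text \<open>
  Put \<open>w(p,\<beta>) = (1 - p \<bullet> \<beta>) p - \<beta>\<close>, the defect of \<open>(p,\<beta>)\<close>. It vanishes exactly on the graph of the flux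
  \<open>\<sigma>\<close>, and \<open>\<beta> - \<sigma>(p)\<close> is no longer than \<open>w\<close>. A computation rewrites the inequality defining the set \<open>S\<^sub>\<delta>\<close> as
  \<open>\<delta> |w| < w \<bullet> \<beta>\<close>; in particular \<open>w \<noteq> 0\<close> there, and \<open>S\<^sub>\<delta>\<close> is bounded for \<open>\<delta> > 0\<close>.

  Let \<open>(p,\<beta>) \<in> S\<^sub>\<delta>\<close> and \<open>q = w/|w|\<close>. There is a vector \<open>\<gamma>\<close> orthogonal to \<open>q\<close> such that \<open>w\<close> stays parallel to \<open>q\<close>
  on the line \<open>(p + s q, \<beta> + s \<gamma>)\<close>, with a coefficient that is a concave quadratic in \<open>s\<close>
  (\<open>S_set_segment\<close>). For small \<open>\<kappa> > 0\<close> let \<open>s1 < 0 < s2\<close> be the parameters at which it equals \<open>\<kappa>\<close>. Between them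
  \<open>|w| \<ge> \<kappa>\<close>, and \<open>q \<bullet> \<beta>\<close> is constant. If \<open>(p,\<beta>)\<close> ranges over a compact set, then all these segments lie in
  one compact subset of \<open>S\<^sub>\<delta>\<close>, which has a neighbourhood in \<open>S\<^sub>\<delta>\<close> (\<open>S_set_perturbation\<close>). This gives a
  \<open>\<rho>\<^sub>0\<close> that does not depend on \<open>(p,\<beta>)\<close> or on the box. At the two ends the distance of \<open>\<beta> + s \<gamma>\<close> from
  \<open>\<sigma>(p + s q)\<close> is at most \<open>\<kappa>\<close>.

  It remains to find \<open>\<phi>\<close> and \<open>\<psi>\<close> of compact support such that \<open>(D\<phi>, \<psi>\<^sub>t)\<close> is uniformly close to
  \<open>(s q, s \<gamma>)\<close>, where \<open>s\<close> has values in \<open>[s1,s2]\<close> and is close to one of the ends outside a set of small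
  measure (\<open>oscillation\<close>). Both are built from one scalar potential
  \<open>u(z) = \<zeta>(z) F(N (q \<bullet> x + b t))\<close>, with a cutoff \<open>\<zeta>\<close>, a bounded profile \<open>F\<close> whose second derivative
  oscillates between \<open>s1\<close> and \<open>s2\<close>, a small \<open>b > 0\<close>, and a large \<open>N\<close>:
  \<open>\<phi> = N\<^sup>-\<^sup>2 D\<^sub>q u\<close> and \<open>\<psi> = (b N\<^sup>2)\<^sup>-\<^sup>1 ((D\<^sub>q u) \<gamma> - (D\<^sub>\<gamma> u) q)\<close>.
  Being a derivative, \<open>\<phi>(\<cdot>,t)\<close> has mean zero; symmetry of second derivatives makes \<open>\<psi>\<close>
  divergence free. Because \<open>q\<close> is a unit vector orthogonal to \<open>\<gamma>\<close>, to leading order in \<open>N\<close> one has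
  \<open>D\<phi> = \<zeta> F'' q\<close>, \<open>\<psi>\<^sub>t = \<zeta> F'' \<gamma>\<close> and \<open>\<phi>\<^sub>t = b \<zeta> F''\<close>, while \<open>\<phi>\<close> and \<open>\<psi>\<close> are of order \<open>1/N\<close>. So \<open>b\<close> makes
  \<open>\<phi>\<^sub>t\<close> small, and \<open>N\<close> makes \<open>\<phi>\<close>, \<open>\<psi>\<close> and the errors small.
\<close>

section \<open>Smooth maps\<close>

lemma Ck_SucI:
  assumes "\<And>x. (f has_derivative f' x) (at x)" "\<And>v. Ck k (\<lambda>x. f' x v)"
  shows "Ck (Suc k) f"
  using assms by auto

text \<open>Existential unfolding of \<open>Ck (Suc k)\<close> is left to this rule; as a rewrite rule it would unfold
  nested orders repeatedly.\<close>

lemma Ck_SucE: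
  assumes "Ck (Suc k) f"
  obtains f' where "\<And>x. (f has_derivative f' x) (at x)" "\<And>v. Ck k (\<lambda>x. f' x v)"
  using assms unfolding Ck.simps(2)[of k] by blast

declare Ck.simps(2) [simp del]

lemma Ck_SucD: "Ck (Suc k) f \<Longrightarrow> Ck k f"
proof (induction k arbitrary: f)
  case 0
  then obtain f' where "\<And>x. (f has_derivative f' x) (at x)" by (rule Ck_SucE) (rule that)
  then show ?case
    by (metis UNIV_I continuous_at_imp_continuous_on has_derivative_continuous Ck.simps(1))
next
  case (Suc k)
  then obtain f' where f': "\<And>x. (f has_derivative f' x) (at x)"
    and ck: "\<And>v. Ck (Suc k) (\<lambda>x. f' x v)"
    using Ck_SucE by blast
  show ?case
    by (rule Ck_SucI[OF f']) (rule Suc.IH[OF ck])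
qed

lemma Ck_const [simp, intro]: "Ck k (\<lambda>x. c)"
proof (induction k arbitrary: c)
  case (Suc k)
  show ?case by (rule Ck_SucI[where f'="\<lambda>x v. 0"]) (auto intro: Suc)
qed auto

lemma Ck_bounded_linear:
  assumes "bounded_linear L"
  shows "Ck k L"
proof (cases k)
  case 0
  then show ?thesis using assms by (auto intro: linear_continuous_on)
next
  case (Suc m)
  show ?thesis unfolding Suc
    by (rule Ck_SucI[where f'="\<lambda>x. L"]) (auto intro: bounded_linear_imp_has_derivative assms)
qed

lemma Ck_linear_image:
  assumes L: "bounded_linear L" and "Ck k f"
  shows "Ck k (\<lambda>x. L (f x))"
  using assms(2)
proof (induction k arbitrary: f)
  case 0
  then show ?case
    by (auto intro: bounded_linear.continuous_on[OF L])
next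
  case (Suc k)
  then obtain f' where f': "\<And>x. (f has_derivative f' x) (at x)"
    and ck: "\<And>v. Ck k (\<lambda>x. f' x v)"
    using Ck_SucE by metis
  show ?case
    by (rule Ck_SucI[where f'="\<lambda>x v. L (f' x v)"])
      (auto intro!: Suc.IH ck bounded_linear.has_derivative[OF L] f')
qed

lemma Ck_add:
  assumes "Ck k f" "Ck k g"
  shows "Ck k (\<lambda>x. f x + g x)"
  using assms
proof (induction k arbitrary: f g)
  case 0
  then show ?case by (auto intro: continuous_intros)
next
  case (Suc k)
  obtain f' where f': "\<And>x. (f has_derivative f' x) (at x)" "\<And>v. Ck k (\<lambda>x. f' x v)"
    by (rule Ck_SucE[OF Suc.prems(1)]) (rule that)
  obtain g' where g': "\<And>x. (g has_derivative g' x) (at x)" "\<And>v. Ck k (\<lambda>x. g' x v)"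
    by (rule Ck_SucE[OF Suc.prems(2)]) (rule that)
  show ?case
    by (rule Ck_SucI[where f'="\<lambda>x v. f' x v + g' x v"])
      (rule has_derivative_add[OF f'(1) g'(1)], rule Suc.IH[OF f'(2) g'(2)])
qed

lemma Ck_scaleR:
  fixes f :: "'a::euclidean_space \<Rightarrow> real"
  assumes "Ck k f" "Ck k g"
  shows "Ck k (\<lambda>x. f x *\<^sub>R g x)"
  using assms
proof (induction k arbitrary: f g)
  case 0
  then show ?case by (auto intro: continuous_intros)
next
  case (Suc k)
  obtain f' where f': "\<And>x. (f has_derivative f' x) (at x)" "\<And>v. Ck k (\<lambda>x. f' x v)"
    by (rule Ck_SucE[OF Suc.prems(1)]) (rule that)
  obtain g' where g': "\<And>x. (g has_derivative g' x) (at x)" "\<And>v. Ck k (\<lambda>x. g' x v)"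
    by (rule Ck_SucE[OF Suc.prems(2)]) (rule that)
  show ?case
    by (rule Ck_SucI[where f'="\<lambda>x v. f x *\<^sub>R g' x v + f' x v *\<^sub>R g x"])
      (rule has_derivative_scaleR[OF f'(1) g'(1)],
        rule Ck_add[OF Suc.IH[OF Ck_SucD[OF Suc.prems(1)] g'(2)] Suc.IH[OF f'(2) Ck_SucD[OF Suc.prems(2)]]])
qed

lemma Ck_mult:
  fixes f g :: "'a::euclidean_space \<Rightarrow> real"
  shows "Ck k f \<Longrightarrow> Ck k g \<Longrightarrow> Ck k (\<lambda>x. f x * g x)"
  using Ck_scaleR[of k f g] by simp

lemma Ck_prod:
  fixes f :: "'i \<Rightarrow> 'a::euclidean_space \<Rightarrow> real"
  assumes "\<And>i. i \<in> A \<Longrightarrow> Ck k (f i)"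
  shows "Ck k (\<lambda>x. \<Prod>i\<in>A. f i x)"
  using assms by (induction A rule: infinite_finite_induct) (auto intro: Ck_mult)

lemma Ck_Pair:
  assumes "Ck k f" "Ck k g"
  shows "Ck k (\<lambda>x. (f x, g x))"
  using assms
proof (induction k arbitrary: f g)
  case 0
  then show ?case by (auto intro: continuous_intros)
next
  case (Suc k)
  obtain f' where f': "\<And>x. (f has_derivative f' x) (at x)" "\<And>v. Ck k (\<lambda>x. f' x v)"
    by (rule Ck_SucE[OF Suc.prems(1)]) (rule that)
  obtain g' where g': "\<And>x. (g has_derivative g' x) (at x)" "\<And>v. Ck k (\<lambda>x. g' x v)"
    by (rule Ck_SucE[OF Suc.prems(2)]) (rule that)
  show ?case
    by (rule Ck_SucI[where f'="\<lambda>x v. (f' x v, g' x v)"])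
      (rule has_derivative_Pair[OF f'(1) g'(1)], rule Suc.IH[OF f'(2) g'(2)])
qed

lemma Ck_compose_real:
  fixes h :: "real \<Rightarrow> real" and g :: "'a::euclidean_space \<Rightarrow> real"
  assumes "Ck k h" "Ck k g"
  shows "Ck k (\<lambda>x. h (g x))"
  using assms
proof (induction k arbitrary: h g)
  case 0
  then show ?case by (auto intro: continuous_on_compose2)
next
  case (Suc k)
  obtain h' where h': "\<And>x. (h has_derivative h' x) (at x)" "\<And>v. Ck k (\<lambda>x. h' x v)"
    by (rule Ck_SucE[OF Suc.prems(1)]) (rule that)
  obtain g' where g': "\<And>x. (g has_derivative g' x) (at x)" "\<And>v. Ck k (\<lambda>x. g' x v)"
    by (rule Ck_SucE[OF Suc.prems(2)]) (rule that)
  have lin: "h' y v = v * h' y 1" for y v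
    using linear_cmul[OF has_derivative_linear[OF h'(1)[of y]], of v 1] by simp
  have "(\<lambda>x. h' (g x) (g' x v)) = (\<lambda>x. g' x v * h' (g x) 1)" for v
    by (rule ext) (rule lin)
  then have "Ck k (\<lambda>x. h' (g x) (g' x v))" for v
    using Ck_mult[OF g'(2)[of v] Suc.IH[OF h'(2)[of 1] Ck_SucD[OF Suc.prems(2)]]] by simp
  then show ?case
    by (intro Ck_SucI[where f'="\<lambda>x v. h' (g x) (g' x v)"])
      (auto intro!: has_derivative_compose[OF g'(1) h'(1)])
qed

lemma Ck_inverse:
  fixes f :: "'a::euclidean_space \<Rightarrow> real"
  assumes "Ck k f" "\<And>x. f x \<noteq> 0"
  shows "Ck k (\<lambda>x. inverse (f x))"
  using assms(1)
proof (induction k)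
  case 0
  then show ?case using assms(2) by (auto intro!: continuous_intros)
next
  case (Suc k)
  then obtain f' where f': "\<And>x. (f has_derivative f' x) (at x)" "\<And>v. Ck k (\<lambda>x. f' x v)"
    using Ck_SucE by metis
  note inv = Suc.IH[OF Ck_SucD[OF Suc.prems]]
  have "Ck k (\<lambda>x. (-1) * (inverse (f x) * f' x v * inverse (f x)))" for v
    by (intro Ck_mult Ck_const inv f')
  then show ?case
    using assms(2)
    by (intro Ck_SucI[where f'="\<lambda>x v. (-1) * (inverse (f x) * f' x v * inverse (f x))"])
      (auto intro!: derivative_eq_intros f')
qed

lemma Ck_DERIV_Suc:
  fixes f :: "real \<Rightarrow> real"
  assumes "\<And>x. (f has_real_derivative g x) (at x)" "Ck k g"
  shows "Ck (Suc k) f"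
  using assms
  by (intro Ck_SucI[where f'="\<lambda>x v. g x * v"])
    (auto simp: has_field_derivative_def intro!: Ck_mult)

text \<open>Infinitely differentiable maps on the whole space.\<close>

definition smooth :: "('a::euclidean_space \<Rightarrow> 'b::real_normed_vector) \<Rightarrow> bool" where
  "smooth f \<longleftrightarrow> (\<forall>k. Ck k f)"

lemma smooth_const [simp]: "smooth (\<lambda>x. c)"
  by (simp add: smooth_def)

lemma smooth_bounded_linear: "bounded_linear L \<Longrightarrow> smooth L"
  by (simp add: smooth_def Ck_bounded_linear)

lemma smooth_linear_image: "bounded_linear L \<Longrightarrow> smooth f \<Longrightarrow> smooth (\<lambda>x. L (f x))"
  by (simp add: smooth_def Ck_linear_image)

lemma smooth_add: "smooth f \<Longrightarrow> smooth g \<Longrightarrow> smooth (\<lambda>x. f x + g x)"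
  by (simp add: smooth_def Ck_add)

lemma smooth_Pair: "smooth f \<Longrightarrow> smooth g \<Longrightarrow> smooth (\<lambda>x. (f x, g x))"
  by (simp add: smooth_def Ck_Pair)

lemma smooth_minus: "smooth f \<Longrightarrow> smooth (\<lambda>x. - f x)"
  by (rule smooth_linear_image[OF bounded_linear_minus[OF bounded_linear_ident]])

lemma smooth_diff: "smooth f \<Longrightarrow> smooth g \<Longrightarrow> smooth (\<lambda>x. f x - g x)"
  using smooth_add[OF _ smooth_minus[of g], of f] by simp

lemma smooth_scaleR:
  fixes f :: "'a::euclidean_space \<Rightarrow> real"
  shows "smooth f \<Longrightarrow> smooth g \<Longrightarrow> smooth (\<lambda>x. f x *\<^sub>R g x)"
  by (auto simp: smooth_def intro: Ck_scaleR)

lemma smooth_mult: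
  fixes f g :: "'a::euclidean_space \<Rightarrow> real"
  shows "smooth f \<Longrightarrow> smooth g \<Longrightarrow> smooth (\<lambda>x. f x * g x)"
  by (auto simp: smooth_def intro: Ck_mult)

lemma smooth_prod:
  fixes f :: "'i \<Rightarrow> 'a::euclidean_space \<Rightarrow> real"
  shows "(\<And>i. i \<in> A \<Longrightarrow> smooth (f i)) \<Longrightarrow> smooth (\<lambda>x. \<Prod>i\<in>A. f i x)"
  by (auto simp: smooth_def intro: Ck_prod)

lemma smooth_compose_real:
  fixes h :: "real \<Rightarrow> real" and g :: "'a::euclidean_space \<Rightarrow> real"
  shows "smooth h \<Longrightarrow> smooth g \<Longrightarrow> smooth (\<lambda>x. h (g x))"
  by (auto simp: smooth_def intro: Ck_compose_real)

lemma smooth_inverse: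
  fixes f :: "'a::euclidean_space \<Rightarrow> real"
  shows "smooth f \<Longrightarrow> (\<And>x. f x \<noteq> 0) \<Longrightarrow> smooth (\<lambda>x. inverse (f x))"
  by (auto simp: smooth_def intro: Ck_inverse)

lemma smooth_antiderivative:
  fixes f :: "real \<Rightarrow> real"
  assumes "\<And>x. (f has_real_derivative g x) (at x)" "smooth g"
  shows "smooth f"
  using assms Ck_SucD[OF Ck_DERIV_Suc[OF assms(1)]] by (auto simp: smooth_def)

lemma smooth_affine_real: "smooth (\<lambda>x::real. a * x + b)"
  by (intro smooth_add smooth_const smooth_bounded_linear bounded_linear_mult_right)

lemma smooth_cos: "smooth (cos :: real \<Rightarrow> real)"
proof -
  have "Ck k (cos :: real \<Rightarrow> real) \<and> Ck k (sin :: real \<Rightarrow> real)" for k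
  proof (induction k)
    case (Suc k)
    have "Ck k (\<lambda>x::real. (-1) * sin x)" by (intro Ck_mult Ck_const) (use Suc in auto)
    then have "Ck (Suc k) (cos :: real \<Rightarrow> real)"
      by (intro Ck_DERIV_Suc[where g="\<lambda>x. (-1) * sin x"]) (auto intro!: derivative_eq_intros)
    moreover have "Ck (Suc k) (sin :: real \<Rightarrow> real)"
      using Suc by (intro Ck_DERIV_Suc[where g=cos]) (auto intro!: derivative_eq_intros)
    ultimately show ?case by blast
  qed (auto intro: continuous_intros)
  then show ?thesis by (auto simp: smooth_def)
qed

section \<open>Directional derivatives\<close>

text \<open>The derivative of \<open>f\<close> in the direction \<open>v\<close>, as a function on the whole space.\<close>

definition dir_deriv :: "'a::euclidean_space \<Rightarrow> ('a \<Rightarrow> 'b::real_normed_vector) \<Rightarrow> 'a \<Rightarrow> 'b" where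
  "dir_deriv v f z = frechet_derivative f (at z) v"

lemma smooth_has_derivative:
  assumes "smooth f"
  shows "(f has_derivative (\<lambda>v. dir_deriv v f z)) (at z)"
proof -
  obtain f' where "(f has_derivative f' z) (at z)"
    using assms unfolding smooth_def by (metis Ck.simps(2))
  then show ?thesis
    using frechet_derivative_works[of f "at z"] by (auto simp: dir_deriv_def differentiable_def)
qed

lemma dir_deriv_eqI:
  assumes "(f has_derivative f') (at z)"
  shows "dir_deriv v f z = f' v"
  using frechet_derivative_at[OF assms] by (simp add: dir_deriv_def)

lemma smooth_dir_deriv:
  assumes "smooth f"
  shows "smooth (dir_deriv v f)"
  unfolding smooth_def
proof
  fix k
  obtain f' where f': "\<And>x. (f has_derivative f' x) (at x)" "\<And>v. Ck k (\<lambda>x. f' x v)"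
    using assms unfolding smooth_def by (metis Ck.simps(2))
  have "dir_deriv v f = (\<lambda>x. f' x v)"
    by (rule ext) (rule dir_deriv_eqI[OF f'(1)])
  then show "Ck k (dir_deriv v f)" using f'(2) by simp
qed

lemma smooth_continuous_on: "smooth f \<Longrightarrow> continuous_on S f"
  unfolding smooth_def using Ck.simps(1) continuous_on_subset by blast

lemma smooth_isCont: "smooth f \<Longrightarrow> isCont f x"
  using smooth_continuous_on continuous_on_eq_continuous_at by blast

lemma dir_deriv_scaleR:
  fixes f :: "'a::euclidean_space \<Rightarrow> real"
  assumes "smooth f" "smooth g"
  shows "dir_deriv v (\<lambda>x. f x *\<^sub>R g x) z = f z *\<^sub>R dir_deriv v g z + dir_deriv v f z *\<^sub>R g z"
  by (rule dir_deriv_eqI[OF has_derivative_scaleR[OF assms[THEN smooth_has_derivative]]])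

lemma dir_deriv_mult:
  fixes f g :: "'a::euclidean_space \<Rightarrow> real"
  assumes "smooth f" "smooth g"
  shows "dir_deriv v (\<lambda>x. f x * g x) z = f z * dir_deriv v g z + dir_deriv v f z * g z"
  using dir_deriv_scaleR[OF assms] by simp

lemma dir_deriv_linear_image:
  assumes "bounded_linear L" "smooth f"
  shows "dir_deriv v (\<lambda>x. L (f x)) z = L (dir_deriv v f z)"
  by (rule dir_deriv_eqI[OF bounded_linear.has_derivative[OF assms(1) smooth_has_derivative[OF assms(2)]]])

lemma dir_deriv_add:
  "smooth f \<Longrightarrow> smooth g \<Longrightarrow> dir_deriv v (\<lambda>x. f x + g x) z = dir_deriv v f z + dir_deriv v g z"
  by (rule dir_deriv_eqI) (intro has_derivative_add smooth_has_derivative)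

lemma dir_deriv_diff:
  "smooth f \<Longrightarrow> smooth g \<Longrightarrow> dir_deriv v (\<lambda>x. f x - g x) z = dir_deriv v f z - dir_deriv v g z"
  by (rule dir_deriv_eqI) (intro has_derivative_diff smooth_has_derivative)

lemma linear_dir_deriv: "smooth f \<Longrightarrow> linear (\<lambda>v. dir_deriv v f z)"
  by (rule has_derivative_linear[OF smooth_has_derivative])

lemma dir_deriv_ridge:
  fixes F F' :: "real \<Rightarrow> real"
  assumes "\<And>y. (F has_real_derivative F' y) (at y)"
  shows "dir_deriv v (\<lambda>z. F (N * (l \<bullet> z))) z = N * (l \<bullet> v) * F' (N * (l \<bullet> z))"
  by (rule dir_deriv_eqI, rule has_derivative_eq_rhs,
      rule DERIV_compose_FDERIV[OF assms]) (auto intro!: derivative_eq_intros)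

lemma dir_deriv_eq_0:
  assumes "closed C" "\<And>z. z \<notin> C \<Longrightarrow> f z = 0" "z \<notin> C"
  shows "dir_deriv v f z = 0"
proof -
  have "(f has_derivative (\<lambda>v. 0)) (at z)"
    by (rule has_derivative_transform_within_open[where f="\<lambda>x. 0" and s="- C"])
      (use assms in auto)
  then show ?thesis by (rule dir_deriv_eqI)
qed

lemma DERIV_dir_deriv:
  fixes f :: "'a::euclidean_space \<Rightarrow> real"
  assumes "smooth f"
  shows "((\<lambda>s. f (x + s *\<^sub>R a)) has_real_derivative dir_deriv a f (x + s *\<^sub>R a)) (at s)"
proof -
  have "((\<lambda>s. f (x + s *\<^sub>R a)) has_derivative (\<lambda>h. dir_deriv (h *\<^sub>R a) f (x + s *\<^sub>R a))) (at s)"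
    by (rule has_derivative_compose[OF _ smooth_has_derivative[OF assms]])
      (auto intro!: derivative_eq_intros)
  then show ?thesis
    by (simp add: has_field_derivative_def linear_cmul[OF linear_dir_deriv[OF assms]] mult.commute[of _ "dir_deriv a f (x + s *\<^sub>R a)"])
qed

text \<open>Symmetry of second derivatives. Both mixed derivatives are limits of the same second
  difference, to which the mean value theorem is applied twice in either order.\<close>

lemma second_difference_dir_deriv:
  fixes f :: "'a::euclidean_space \<Rightarrow> real"
  assumes "smooth f" "h > 0"
  obtains \<xi> \<eta> where "0 < \<xi>" "\<xi> < h" "0 < \<eta>" "\<eta> < h"
    "f (x + h *\<^sub>R a + h *\<^sub>R b) - f (x + h *\<^sub>R a) - f (x + h *\<^sub>R b) + f x
      = h\<^sup>2 * dir_deriv b (dir_deriv a f) (x + \<xi> *\<^sub>R a + \<eta> *\<^sub>R b)"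
proof -
  have d: "((\<lambda>s. f (x + h *\<^sub>R b + s *\<^sub>R a) - f (x + s *\<^sub>R a)) has_real_derivative
      dir_deriv a f (x + h *\<^sub>R b + s *\<^sub>R a) - dir_deriv a f (x + s *\<^sub>R a)) (at s)" for s
    by (intro DERIV_diff DERIV_dir_deriv assms)
  obtain \<xi> where \<xi>: "0 < \<xi>" "\<xi> < h" and
    1: "(f (x + h *\<^sub>R b + h *\<^sub>R a) - f (x + h *\<^sub>R a)) - (f (x + h *\<^sub>R b + 0 *\<^sub>R a) - f (x + 0 *\<^sub>R a))
      = (h - 0) * (dir_deriv a f (x + h *\<^sub>R b + \<xi> *\<^sub>R a) - dir_deriv a f (x + \<xi> *\<^sub>R a))"
    using MVT2[OF assms(2) d] by blast
  obtain \<eta> where \<eta>: "0 < \<eta>" "\<eta> < h" and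
    2: "dir_deriv a f (x + \<xi> *\<^sub>R a + h *\<^sub>R b) - dir_deriv a f (x + \<xi> *\<^sub>R a + 0 *\<^sub>R b)
      = (h - 0) * dir_deriv b (dir_deriv a f) (x + \<xi> *\<^sub>R a + \<eta> *\<^sub>R b)"
    using MVT2[OF assms(2) DERIV_dir_deriv[OF smooth_dir_deriv[OF assms(1)]]] by blast
  show ?thesis
    by (rule that[OF \<xi> \<eta>]) (use 1 2 in \<open>simp add: add_ac power2_eq_square algebra_simps\<close>)
qed

lemma dir_deriv_commute:
  fixes f :: "'a::euclidean_space \<Rightarrow> real"
  assumes "smooth f"
  shows "dir_deriv a (dir_deriv b f) x = dir_deriv b (dir_deriv a f) x"
proof (rule ccontr)
  let ?A = "dir_deriv a (dir_deriv b f)" and ?B = "dir_deriv b (dir_deriv a f)"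
  assume ne: "?A x \<noteq> ?B x"
  define e where "e = \<bar>?A x - ?B x\<bar> / 2"
  have e: "e > 0" using ne by (simp add: e_def)
  have "isCont ?A x" "isCont ?B x"
    by (intro smooth_isCont smooth_dir_deriv assms)+
  then obtain d1 d2 where d: "d1 > 0" "d2 > 0"
    and A: "\<And>y. dist y x < d1 \<Longrightarrow> dist (?A y) (?A x) < e"
    and B: "\<And>y. dist y x < d2 \<Longrightarrow> dist (?B y) (?B x) < e"
    unfolding continuous_at_eps_delta using e by metis
  define h where "h = min d1 d2 / (norm a + norm b + 1)"
  have pos: "norm a + norm b + 1 > 0" by (simp add: add_nonneg_pos)
  have h: "h > 0" using d pos by (simp add: h_def)
  have near: "dist (x + \<xi> *\<^sub>R a + \<eta> *\<^sub>R b) x < min d1 d2"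
    if "0 < \<xi>" "\<xi> < h" "0 < \<eta>" "\<eta> < h" for \<xi> \<eta>
  proof -
    have "dist (x + \<xi> *\<^sub>R a + \<eta> *\<^sub>R b) x = norm (\<xi> *\<^sub>R a + \<eta> *\<^sub>R b)"
      by (simp add: dist_norm add.assoc)
    also have "\<dots> \<le> \<xi> * norm a + \<eta> * norm b"
      using norm_triangle_ineq[of "\<xi> *\<^sub>R a" "\<eta> *\<^sub>R b"] that by simp
    also have "\<dots> \<le> h * norm a + h * norm b"
      by (intro add_mono mult_right_mono) (use that in auto)
    also have "\<dots> < h * (norm a + norm b + 1)" using h by (simp add: algebra_simps)
    also have "\<dots> = min d1 d2" using pos by (simp add: h_def)
    finally show ?thesis .
  qed
  obtain \<xi> \<eta> where 1: "0 < \<xi>" "\<xi> < h" "0 < \<eta>" "\<eta> < h"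
    "f (x + h *\<^sub>R a + h *\<^sub>R b) - f (x + h *\<^sub>R a) - f (x + h *\<^sub>R b) + f x
      = h\<^sup>2 * ?B (x + \<xi> *\<^sub>R a + \<eta> *\<^sub>R b)"
    using second_difference_dir_deriv[OF assms h] by metis
  obtain \<xi>' \<eta>' where 2: "0 < \<xi>'" "\<xi>' < h" "0 < \<eta>'" "\<eta>' < h"
    "f (x + h *\<^sub>R b + h *\<^sub>R a) - f (x + h *\<^sub>R b) - f (x + h *\<^sub>R a) + f x
      = h\<^sup>2 * ?A (x + \<xi>' *\<^sub>R b + \<eta>' *\<^sub>R a)"
    using second_difference_dir_deriv[OF assms h] by metis
  have sw: "x + \<xi>' *\<^sub>R b + \<eta>' *\<^sub>R a = x + \<eta>' *\<^sub>R a + \<xi>' *\<^sub>R b"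
    "x + h *\<^sub>R b + h *\<^sub>R a = x + h *\<^sub>R a + h *\<^sub>R b" by (simp_all add: add_ac)
  have "h\<^sup>2 * ?A (x + \<eta>' *\<^sub>R a + \<xi>' *\<^sub>R b) = h\<^sup>2 * ?B (x + \<xi> *\<^sub>R a + \<eta> *\<^sub>R b)"
    using 1(5) 2(5) unfolding sw by linarith
  then have "?A (x + \<eta>' *\<^sub>R a + \<xi>' *\<^sub>R b) = ?B (x + \<xi> *\<^sub>R a + \<eta> *\<^sub>R b)" using h by simp
  moreover have "dist (?A (x + \<eta>' *\<^sub>R a + \<xi>' *\<^sub>R b)) (?A x) < e" using A near 2 by force
  moreover have "dist (?B (x + \<xi> *\<^sub>R a + \<eta> *\<^sub>R b)) (?B x) < e" using B near 1 by force
  ultimately show False unfolding e_def dist_real_def by (smt (verit) field_sum_of_halves)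
qed

section \<open>Smooth step and cutoff functions\<close>

text \<open>The functions \<open>p(1/x) exp(-1/x)\<close>, extended by zero to \<open>x \<le> 0\<close>, with \<open>p\<close> a polynomial. This family
  is closed under differentiation, and \<open>p = 1\<close> is the usual flat function.\<close>

definition flat_exp :: "real poly \<Rightarrow> real \<Rightarrow> real" where
  "flat_exp p x = (if x > 0 then poly p (1 / x) * exp (- (1 / x)) else 0)"

lemma tendsto_poly_exp_0:
  fixes p :: "real poly"
  shows "((\<lambda>y. poly p y * exp (- y)) \<longlongrightarrow> 0) at_top"
proof -
  have "((\<lambda>y. \<Sum>i\<le>degree p. coeff p i * (y ^ i / exp y)) \<longlongrightarrow> (\<Sum>i\<le>degree p. coeff p i * 0)) at_top"
    by (intro tendsto_sum tendsto_mult tendsto_const tendsto_power_div_exp_0)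
  then show ?thesis
    by (simp add: poly_altdef sum_distrib_right exp_minus divide_inverse mult.assoc)
qed

lemma flat_exp_over_x_tendsto_0: "((\<lambda>x. flat_exp p x / x) \<longlongrightarrow> 0) (at 0)"
proof -
  have "((\<lambda>x. poly (pCons 0 p) (inverse x) * exp (- inverse x)) \<longlongrightarrow> 0) (at_right 0)"
    by (rule filterlim_compose[OF tendsto_poly_exp_0 filterlim_inverse_at_top_right])
  then have "((\<lambda>x. flat_exp p x / x) \<longlongrightarrow> 0) (at_right 0)"
    by (rule Lim_transform_eventually)
      (auto simp: flat_exp_def divide_inverse eventually_at_filter intro!: always_eventually)
  moreover have "((\<lambda>x. flat_exp p x / x) \<longlongrightarrow> 0) (at_left 0)"
    by (rule Lim_transform_eventually[OF tendsto_const])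
      (auto simp: flat_exp_def eventually_at_filter intro!: always_eventually)
  ultimately show ?thesis by (simp add: filterlim_at_split)
qed

lemma DERIV_flat_exp:
  "(flat_exp p has_real_derivative flat_exp (pCons 0 (pCons 0 (p - pderiv p))) x) (at x)"
proof -
  consider "x > 0" | "x < 0" | "x = 0" by linarith
  then show ?thesis
  proof cases
    case 1
    have "((\<lambda>x. poly p (1 / x) * exp (- (1 / x))) has_real_derivative
        flat_exp (pCons 0 (pCons 0 (p - pderiv p))) x) (at x)"
      using 1 by (auto intro!: derivative_eq_intros DERIV_chain2[OF poly_DERIV]
          simp: flat_exp_def field_simps power2_eq_square)
    then show ?thesis
      by (rule has_field_derivative_transform_within_open[where S="{0<..}"])
        (use 1 in \<open>auto simp: flat_exp_def\<close>)
  next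
    case 2
    have "((\<lambda>x. 0) has_real_derivative flat_exp (pCons 0 (pCons 0 (p - pderiv p))) x) (at x)"
      using 2 by (auto simp: flat_exp_def)
    then show ?thesis
      by (rule has_field_derivative_transform_within_open[where S="{..<0}"])
        (use 2 in \<open>auto simp: flat_exp_def\<close>)
  next
    case 3
    show ?thesis unfolding 3 has_field_derivative_iff
      using flat_exp_over_x_tendsto_0[of p] by (simp add: flat_exp_def[of _ 0])
  qed
qed

lemma smooth_flat_exp: "smooth (flat_exp p)"
proof -
  have "Ck k (flat_exp p)" for k
  proof (induction k arbitrary: p)
    case 0
    show ?case using DERIV_continuous[OF DERIV_flat_exp[of p]]
      by (simp add: continuous_at_imp_continuous_on)
  next
    case (Suc k)
    show ?case by (rule Ck_DERIV_Suc[OF DERIV_flat_exp Suc])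
  qed
  then show ?thesis by (simp add: smooth_def)
qed

lemma smooth_step:
  obtains h :: "real \<Rightarrow> real" where "smooth h" "\<And>x. 0 \<le> h x" "\<And>x. h x \<le> 1"
    "\<And>x. x \<le> 0 \<Longrightarrow> h x = 0" "\<And>x. x \<ge> 1 \<Longrightarrow> h x = 1"
proof -
  define e where "e = flat_exp 1"
  have e: "e x \<ge> 0" "e x > 0 \<longleftrightarrow> x > 0" "x \<le> 0 \<Longrightarrow> e x = 0" for x
    by (auto simp: e_def flat_exp_def)
  have pos: "e x + e (1 - x) > 0" for x
    using e(1)[of x] e(1)[of "1 - x"] e(2)[of x] e(2)[of "1 - x"] by linarith
  define h where "h x = e x * inverse (e x + e (1 - x))" for x
  have "smooth (\<lambda>x. e (1 - x))"
    using smooth_compose_real[OF smooth_flat_exp[of 1] smooth_affine_real[of "-1" 1]]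
    by (simp add: e_def)
  then have "smooth h"
    unfolding h_def using pos
    by (intro smooth_mult smooth_inverse smooth_add) (auto simp: e_def smooth_flat_exp less_imp_neq[symmetric])
  moreover have "0 \<le> h x" for x
    unfolding h_def using e(1)[of x] pos[of x] by simp
  moreover have "h x \<le> 1" for x
    unfolding h_def using e(1)[of x] e(1)[of "1 - x"] pos[of x] by (simp add: field_simps)
  moreover have "h x = 0" if "x \<le> 0" for x
    unfolding h_def using e(3)[OF that] by simp
  moreover have "h x = 1" if "x \<ge> 1" for x
    unfolding h_def using e(3)[of "1 - x"] pos[of x] that by simp
  ultimately show ?thesis by (rule that)
qed

text \<open>A cutoff supported in a compact subset of the box and equal to \<open>1\<close> on all of
  it but a set of measure at most \<open>\<tau>\<close>.\<close>

lemma smooth_box_cutoff: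
  fixes c d :: "'a::euclidean_space"
  assumes ne: "box c d \<noteq> {}" and \<tau>: "\<tau> > 0"
  obtains \<zeta> :: "'a \<Rightarrow> real" and C B where "smooth \<zeta>" "\<And>z. 0 \<le> \<zeta> z" "\<And>z. \<zeta> z \<le> 1"
    "compact C" "C \<subseteq> box c d" "\<And>z. z \<notin> C \<Longrightarrow> \<zeta> z = 0"
    "B \<in> sets lborel" "\<And>z. z \<in> B \<Longrightarrow> \<zeta> z = 1"
    "measure lborel (box c d - B) \<le> \<tau>"
proof -
  obtain h :: "real \<Rightarrow> real" where h: "smooth h" "\<And>x. 0 \<le> h x" "\<And>x. h x \<le> 1"
    "\<And>x. x \<le> 0 \<Longrightarrow> h x = 0" "\<And>x. x \<ge> 1 \<Longrightarrow> h x = 1"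
    using smooth_step by blast
  have w: "c \<bullet> b < d \<bullet> b" if "b \<in> Basis" for b
    using ne that by (auto simp: box_ne_empty)
  define M where "M = measure lborel (box c d)"
  have M: "M = (\<Prod>b\<in>Basis. (d - c) \<bullet> b)"
    unfolding M_def using w by (intro measure_lborel_box) (auto intro: less_imp_le)
  have M0: "M > 0" unfolding M using w by (intro prod_pos) (auto simp: inner_diff_left)
  define n where "n = DIM('a)"
  have n: "n > 0" by (simp add: n_def)
  \<comment> \<open>Shrinking each side by the factor \<open>1 - 4 r\<close> removes at most the fraction \<open>4 r n\<close> of the volume,
    by Bernoulli's inequality.\<close>
  define r where "r = min (1/8) (\<tau> / (4 * n * M))"
  have r: "r > 0" "r \<le> 1/8" "4 * r * n * M \<le> \<tau>"
  proof -
    show "r > 0" using \<tau> M0 n by (simp add: r_def)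
    show "r \<le> 1/8" by (simp add: r_def)
    have "r \<le> \<tau> / (4 * n * M)" by (simp add: r_def)
    then show "4 * r * n * M \<le> \<tau>" using M0 n by (simp add: field_simps)
  qed
  define C where "C = cbox (c + r *\<^sub>R (d - c)) (d - r *\<^sub>R (d - c))"
  define B where "B = cbox (c + (2 * r) *\<^sub>R (d - c)) (d - (2 * r) *\<^sub>R (d - c))"
  define \<zeta> where "\<zeta> z = (\<Prod>b\<in>Basis. h ((z \<bullet> b - c \<bullet> b) / (r * (d \<bullet> b - c \<bullet> b)) - 1)
     * h ((d \<bullet> b - z \<bullet> b) / (r * (d \<bullet> b - c \<bullet> b)) - 1))" for z
  have "smooth \<zeta>"
  proof -
    have 1: "smooth (\<lambda>z::'a. h (\<alpha> * (z \<bullet> b) + \<beta>))" for \<alpha> \<beta> b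
      by (intro smooth_compose_real[OF h(1)] smooth_compose_real[OF smooth_affine_real]
          smooth_bounded_linear bounded_linear_inner_left)
    have eq: "\<zeta> = (\<lambda>z. \<Prod>b\<in>Basis. h (1 / (r * (d \<bullet> b - c \<bullet> b)) * (z \<bullet> b) + (- (c \<bullet> b) / (r * (d \<bullet> b - c \<bullet> b)) - 1))
       * h (- 1 / (r * (d \<bullet> b - c \<bullet> b)) * (z \<bullet> b) + (d \<bullet> b / (r * (d \<bullet> b - c \<bullet> b)) - 1)))"
      by (rule ext) (simp add: \<zeta>_def diff_divide_distrib algebra_simps)
    show ?thesis unfolding eq by (intro smooth_prod smooth_mult 1)
  qed
  moreover have "0 \<le> \<zeta> z" for z
    unfolding \<zeta>_def by (intro prod_nonneg mult_nonneg_nonneg h)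
  moreover have "\<zeta> z \<le> 1" for z
    unfolding \<zeta>_def by (intro prod_le_1 conjI mult_nonneg_nonneg mult_le_one h)
  moreover have "compact C" "B \<in> sets lborel" by (simp_all add: C_def B_def)
  moreover have sub: "C \<subseteq> box c d" "B \<subseteq> box c d"
  proof -
    have "0 < r * (d \<bullet> b - c \<bullet> b)" if "b \<in> Basis" for b using w[OF that] r by simp
    then show "C \<subseteq> box c d" "B \<subseteq> box c d"
      unfolding C_def B_def by (fastforce simp: mem_box inner_simps)+
  qed
  moreover have "\<zeta> z = 0" if "z \<notin> C" for z
  proof -
    have "\<exists>b\<in>Basis. z \<bullet> b < c \<bullet> b + r * (d \<bullet> b - c \<bullet> b) \<or> z \<bullet> b > d \<bullet> b - r * (d \<bullet> b - c \<bullet> b)"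
      using that unfolding C_def mem_box by (auto simp: inner_simps not_le)
    then obtain b where b: "b \<in> Basis"
      and out: "z \<bullet> b < c \<bullet> b + r * (d \<bullet> b - c \<bullet> b) \<or> z \<bullet> b > d \<bullet> b - r * (d \<bullet> b - c \<bullet> b)"
      by blast
    have p: "r * (d \<bullet> b - c \<bullet> b) > 0" using r w[OF b] by simp
    have "h ((z \<bullet> b - c \<bullet> b) / (r * (d \<bullet> b - c \<bullet> b)) - 1)
     * h ((d \<bullet> b - z \<bullet> b) / (r * (d \<bullet> b - c \<bullet> b)) - 1) = 0"
      using out
    proof
      assume "z \<bullet> b < c \<bullet> b + r * (d \<bullet> b - c \<bullet> b)"
      then have "(z \<bullet> b - c \<bullet> b) / (r * (d \<bullet> b - c \<bullet> b)) - 1 \<le> 0"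
        using p by (simp add: pos_divide_le_eq)
      then show ?thesis using h(4) by simp
    next
      assume "z \<bullet> b > d \<bullet> b - r * (d \<bullet> b - c \<bullet> b)"
      then have "(d \<bullet> b - z \<bullet> b) / (r * (d \<bullet> b - c \<bullet> b)) - 1 \<le> 0"
        using p by (simp add: pos_divide_le_eq)
      then show ?thesis using h(4) by simp
    qed
    then show ?thesis unfolding \<zeta>_def using b by (intro prod_zero) auto
  qed
  moreover have "\<zeta> z = 1" if "z \<in> B" for z
  proof -
    have "h ((z \<bullet> b - c \<bullet> b) / (r * (d \<bullet> b - c \<bullet> b)) - 1)
     * h ((d \<bullet> b - z \<bullet> b) / (r * (d \<bullet> b - c \<bullet> b)) - 1) = 1" if b: "b \<in> Basis" for b
    proof -
      have p: "r * (d \<bullet> b - c \<bullet> b) > 0" using r w[OF b] by simp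
      have "c \<bullet> b + 2 * r * (d \<bullet> b - c \<bullet> b) \<le> z \<bullet> b" "z \<bullet> b \<le> d \<bullet> b - 2 * r * (d \<bullet> b - c \<bullet> b)"
        using \<open>z \<in> B\<close> b unfolding B_def mem_box by (auto simp: inner_simps)
      then have "2 * (r * (d \<bullet> b - c \<bullet> b)) \<le> z \<bullet> b - c \<bullet> b" "2 * (r * (d \<bullet> b - c \<bullet> b)) \<le> d \<bullet> b - z \<bullet> b"
        by linarith+
      then have "2 \<le> (z \<bullet> b - c \<bullet> b) / (r * (d \<bullet> b - c \<bullet> b))" "2 \<le> (d \<bullet> b - z \<bullet> b) / (r * (d \<bullet> b - c \<bullet> b))"
        using p by (simp_all only: pos_le_divide_eq)
      then show ?thesis using h(5) by simp
    qed
    then show ?thesis unfolding \<zeta>_def by simp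
  qed
  moreover have "measure lborel (box c d - B) \<le> \<tau>"
  proof -
    have le: "(c + (2 * r) *\<^sub>R (d - c)) \<bullet> b \<le> (d - (2 * r) *\<^sub>R (d - c)) \<bullet> b" if "b \<in> Basis" for b
    proof -
      have "4 * r * (d \<bullet> b - c \<bullet> b) \<le> 1 * (d \<bullet> b - c \<bullet> b)"
        using w[OF that] r by (intro mult_right_mono) auto
      then show ?thesis by (simp add: inner_simps algebra_simps)
    qed
    have "measure lborel B = (\<Prod>b\<in>Basis. (d - (2 * r) *\<^sub>R (d - c) - (c + (2 * r) *\<^sub>R (d - c))) \<bullet> b)"
      unfolding B_def using le by (rule measure_lborel_cbox)
    also have "\<dots> = (\<Prod>b\<in>Basis. (1 - 4 * r) * ((d - c) \<bullet> b))"
      by (intro prod.cong) (auto simp: inner_simps algebra_simps)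
    also have "\<dots> = (1 - 4 * r) ^ n * M" by (simp add: prod.distrib n_def M)
    finally have mB: "measure lborel B = (1 - 4 * r) ^ n * M" .
    have "1 + real n * (- 4 * r) \<le> (1 + (- 4 * r)) ^ n"
      by (rule Bernoulli_inequality) (use r in auto)
    then have "(1 - 4 * r * n) * M \<le> (1 - 4 * r) ^ n * M"
      using M0 by (intro mult_right_mono) (auto simp: mult_ac)
    then have "M - measure lborel B \<le> \<tau>" using r(3) by (simp add: mB algebra_simps)
    moreover have "measure lborel (box c d - B) = M - measure lborel B"
      unfolding M_def
      by (rule measure_Diff) (use sub in \<open>auto simp: B_def emeasure_lborel_box_eq\<close>)
    ultimately show ?thesis by simp
  qed
  ultimately show ?thesis using that[of \<zeta> C B] by blast
qed

section \<open>The oscillation profile\<close>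

lemma periodic_2pi_int:
  fixes F :: "real \<Rightarrow> real"
  assumes "\<And>y. F (y + 2 * pi) = F y"
  shows "F (y + of_int n * (2 * pi)) = F y"
proof -
  interpret periodic_fun_simple F "2 * pi" by standard (rule assms)
  show ?thesis by (rule plus_of_int)
qed

lemma periodic_2pi_bounded:
  fixes F :: "real \<Rightarrow> real"
  assumes "continuous_on UNIV F" "\<And>y. F (y + 2 * pi) = F y"
  obtains B where "B > 0" "\<And>y. \<bar>F y\<bar> \<le> B"
proof -
  have "compact (F ` {0..2 * pi})"
    by (intro compact_continuous_image continuous_on_subset[OF assms(1)]) auto
  then obtain B where B: "B > 0" "\<And>y. y \<in> {0..2 * pi} \<Longrightarrow> \<bar>F y\<bar> \<le> B"
    using compact_imp_bounded bounded_pos by (metis (no_types, lifting) image_eqI real_norm_def)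
  have "\<bar>F y\<bar> \<le> B" for y
  proof -
    define n where "n = \<lfloor>y / (2 * pi)\<rfloor>"
    have "of_int n \<le> y / (2 * pi)" "y / (2 * pi) \<le> of_int n + 1"
      unfolding n_def by linarith+
    then have "of_int n * (2 * pi) \<le> y" "y \<le> (of_int n + 1) * (2 * pi)"
      by (simp_all add: pos_le_divide_eq pos_divide_le_eq)
    then have "y - of_int n * (2 * pi) \<in> {0..2 * pi}" by (simp add: algebra_simps)
    moreover have "F y = F (y - of_int n * (2 * pi))"
      using periodic_2pi_int[of F "y - of_int n * (2 * pi)" n] assms(2) by simp
    ultimately show ?thesis using B(2) by simp
  qed
  with B(1) show ?thesis by (rule that)
qed

lemma has_integral_const_2pi: "((\<lambda>x. m :: real) has_integral 2 * pi * m) {0..2 * pi}"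
  using has_integral_const_real[of m 0 "2 * pi"] by simp

text \<open>Subtracting the mean \<open>m\<close> of a periodic function leaves one with a periodic, hence bounded,
  antiderivative.\<close>

lemma periodic_2pi_antiderivative:
  fixes g :: "real \<Rightarrow> real"
  assumes g: "continuous_on UNIV g" "\<And>y. g (y + 2 * pi) = g y"
    and m: "(g has_integral 2 * pi * m) {0..2 * pi}"
  obtains F B where "\<And>y. (F has_real_derivative g y - m) (at y)" "\<And>y. F (y + 2 * pi) = F y"
    "B > 0" "\<And>y. \<bar>F y\<bar> \<le> B"
proof -
  have "\<exists>F. \<forall>y. - \<infinity> < ereal y \<longrightarrow> ereal y < \<infinity> \<longrightarrow> (F has_vector_derivative g y - m) (at y)"
    by (intro einterval_antiderivative)
      (use g(1) in \<open>auto simp: continuous_on_eq_continuous_at intro!: continuous_intros\<close>)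
  then obtain F where F: "\<And>y. (F has_real_derivative g y - m) (at y)"
    by (auto simp: has_real_derivative_iff_has_vector_derivative)
  have "((\<lambda>y. g y - m) has_integral (F (2 * pi) - F 0)) {0..2 * pi}"
    by (intro fundamental_theorem_of_calculus)
      (auto simp: has_real_derivative_iff_has_vector_derivative[symmetric] intro: F DERIV_subset)
  moreover have "((\<lambda>y. g y - m) has_integral (2 * pi * m - 2 * pi * m)) {0..2 * pi}"
    by (intro has_integral_diff m has_integral_const_2pi)
  ultimately have "F (2 * pi) - F 0 = 2 * pi * m - 2 * pi * m" by (rule has_integral_unique)
  then have F0: "F (2 * pi) = F 0" by simp
  have "((\<lambda>y. F (y + 2 * pi) - F y) has_real_derivative 0) (at y)" for y
  proof -
    have "((\<lambda>y. F (y + 2 * pi) - F y) has_real_derivative (g (y + 2 * pi) - m) * 1 - (g y - m)) (at y)"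
      by (intro DERIV_diff F DERIV_chain2[OF F]) (auto intro!: derivative_eq_intros)
    then show ?thesis by (simp add: g(2))
  qed
  then have "F (y + 2 * pi) - F y = F (0 + 2 * pi) - F 0" for y
    by (intro DERIV_isconst_all[of "\<lambda>y. F (y + 2 * pi) - F y"]) auto
  then have per: "F (y + 2 * pi) = F y" for y using F0 by simp
  have "continuous_on UNIV F"
    using F DERIV_isCont continuous_at_imp_continuous_on by blast
  then obtain B where "B > 0" "\<And>y. \<bar>F y\<bar> \<le> B" using periodic_2pi_bounded per by blast
  with F per show ?thesis by (rule that)
qed

lemma has_integral_indicator_Icc:
  fixes a b c d :: real
  assumes "c \<le> a" "a \<le> b" "b \<le> d"
  shows "((indicator {a..b} :: real \<Rightarrow> real) has_integral (b - a)) {c..d}"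
proof -
  have "((\<lambda>x. if x \<in> {a..b} then 1 else 0) has_integral (b - a)) {c..d}"
    using has_integral_const_real[of "1::real" a b] assms
    by (subst has_integral_restrict) auto
  then show ?thesis by (rule has_integral_eq[rotated]) (auto simp: indicator_def)
qed

text \<open>The set where \<open>c < cos y < c + \<tau>\<close> within a period consists of two arcs, whose lengths are
  controlled by the modulus of continuity of \<open>arccos\<close>, uniformly in \<open>c\<close>.\<close>

lemma integral_cos_window_le:
  fixes v :: "real \<Rightarrow> real"
  assumes c: "- 1 \<le> c + \<tau>" "c \<le> 1" and \<tau>: "\<tau> > 0"
    and v: "continuous_on {0..2 * pi} v" "\<And>y. 0 \<le> v y" "\<And>y. v y \<le> 1"
    "\<And>y. v y \<noteq> 0 \<Longrightarrow> c < cos y \<and> cos y < c + \<tau>"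
  shows "integral {0..2 * pi} v \<le> 2 * (arccos (max (- 1) c) - arccos (min 1 (c + \<tau>)))"
proof -
  define \<alpha> where "\<alpha> = arccos (min 1 (c + \<tau>))"
  define \<beta> where "\<beta> = arccos (max (- 1) c)"
  have ord: "0 \<le> \<alpha>" "\<alpha> \<le> \<beta>" "\<beta> \<le> pi"
    unfolding \<alpha>_def \<beta>_def using c \<tau> by (auto intro!: arccos_lbound arccos_ubound arccos_le_mono[THEN iffD2])
  have win: "y \<in> {\<alpha>..\<beta>}" if "0 \<le> y" "y \<le> pi" "c < cos y" "cos y < c + \<tau>" for y
  proof -
    have "arccos (min 1 (c + \<tau>)) \<le> arccos (cos y)" "arccos (cos y) \<le> arccos (max (- 1) c)"
      using that c by (auto intro!: arccos_le_arccos)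
    then show ?thesis using that by (simp add: \<alpha>_def \<beta>_def arccos_cos)
  qed
  have "v y \<le> indicator {\<alpha>..\<beta>} y + indicator {2 * pi - \<beta>..2 * pi - \<alpha>} y"
    if y: "y \<in> {0..2 * pi}" for y
  proof (cases "v y = 0")
    case False
    have "y \<in> {\<alpha>..\<beta>} \<or> 2 * pi - y \<in> {\<alpha>..\<beta>}"
    proof (cases "y \<le> pi")
      case True
      then show ?thesis using win[of y] v(4)[OF False] y by auto
    next
      case nle: False
      have "cos (2 * pi - y) = cos y" by (simp add: cos_diff)
      then show ?thesis using win[of "2 * pi - y"] v(4)[OF False] y nle by auto
    qed
    then show ?thesis using v(3)[of y] by (auto simp: indicator_def)
  qed simp
  moreover have "v integrable_on {0..2 * pi}" by (rule integrable_continuous_real[OF v(1)])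
  moreover have "((\<lambda>y. indicator {\<alpha>..\<beta>} y + indicator {2 * pi - \<beta>..2 * pi - \<alpha>} y)
      has_integral ((\<beta> - \<alpha>) + ((2 * pi - \<alpha>) - (2 * pi - \<beta>)))) {0..2 * pi}"
    by (intro has_integral_add has_integral_indicator_Icc) (use ord in auto)
  ultimately have "integral {0..2 * pi} v \<le> (\<beta> - \<alpha>) + ((2 * pi - \<alpha>) - (2 * pi - \<beta>))"
    by (intro has_integral_le[OF integrable_integral]) auto
  then show ?thesis by (simp add: \<alpha>_def \<beta>_def)
qed

text \<open>A smooth periodic function with prescribed mean \<open>\<theta>\<close> that is \<open>0\<close> or \<open>1\<close> except on a set of small
  measure: a steep smooth step applied to \<open>cos y - c\<close>. The threshold \<open>c\<close> that gives the mean exists by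
  the intermediate value theorem. It depends on the steepness \<open>1/\<tau>\<close>, so that \<open>\<tau>\<close> has to be chosen
  uniformly in \<open>c\<close>.\<close>

lemma smooth_periodic_switch:
  fixes \<theta> \<epsilon> :: real
  assumes \<theta>: "0 < \<theta>" "\<theta> < 1" and \<epsilon>: "\<epsilon> > 0"
  obtains H :: "real \<Rightarrow> real" where "smooth H" "\<And>y. H (y + 2 * pi) = H y" "\<And>y. 0 \<le> H y"
    "\<And>y. H y \<le> 1" "(H has_integral 2 * pi * \<theta>) {0..2 * pi}"
    "integral {0..2 * pi} (\<lambda>y. H y * (1 - H y)) < \<epsilon>"
proof -
  obtain h :: "real \<Rightarrow> real" where h: "smooth h" "\<And>x. 0 \<le> h x" "\<And>x. h x \<le> 1"
    "\<And>x. x \<le> 0 \<Longrightarrow> h x = 0" "\<And>x. x \<ge> 1 \<Longrightarrow> h x = 1"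
    using smooth_step by blast
  have "uniformly_continuous_on {- 1..1} arccos"
    by (intro compact_uniformly_continuous continuous_on_arccos') auto
  then obtain d where d: "d > 0"
    "\<And>x y. x \<in> {- 1..1} \<Longrightarrow> y \<in> {- 1..1} \<Longrightarrow> dist y x < d \<Longrightarrow> dist (arccos y) (arccos x) < \<epsilon> / 2"
    unfolding uniformly_continuous_on_def using \<epsilon> by (metis half_gt_zero)
  define \<tau> where "\<tau> = d / 2"
  have \<tau>: "\<tau> > 0" "\<tau> < d" using d by (auto simp: \<tau>_def)
  define T where "T c = integral {0..2 * pi} (\<lambda>y. h ((cos y - c) / \<tau>))" for c
  have hc: "continuous_on S h" for S by (rule smooth_continuous_on[OF h(1)])
  have cont: "continuous_on {- 1 - \<tau>..1} T"
    unfolding T_def cbox_interval[symmetric]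
    by (rule integral_continuous_on_param)
      (use \<tau> in \<open>auto simp: case_prod_unfold intro!: continuous_on_compose2[OF hc[of UNIV]] continuous_intros\<close>)
  have "T (- 1 - \<tau>) = integral {0..2 * pi} (\<lambda>y. 1)"
    unfolding T_def
  proof (rule integral_cong)
    fix y
    have "\<tau> \<le> cos y - (- 1 - \<tau>)" using cos_ge_minus_one[of y] by linarith
    then show "h ((cos y - (- 1 - \<tau>)) / \<tau>) = 1"
      by (intro h(5)) (simp add: pos_le_divide_eq \<tau>)
  qed
  then have T1: "T (- 1 - \<tau>) = 2 * pi" by simp
  have "T 1 = integral {0..2 * pi} (\<lambda>y. 0)"
    unfolding T_def using \<tau> by (intro integral_cong h(4)) (simp add: pos_divide_le_eq)
  then have T2: "T 1 = 0" by simp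
  have "\<exists>c. - 1 - \<tau> \<le> c \<and> c \<le> 1 \<and> T c = 2 * pi * \<theta>"
    by (rule IVT2'[OF _ _ _ cont]) (use T1 T2 \<theta> \<tau> in auto)
  then obtain c where c: "- 1 - \<tau> \<le> c" "c \<le> 1" "T c = 2 * pi * \<theta>" by blast
  define H where "H y = h ((cos y - c) / \<tau>)" for y
  have "smooth (\<lambda>y. h (1 / \<tau> * cos y + (- c / \<tau>)))"
    by (intro smooth_compose_real[OF h(1)] smooth_compose_real[OF smooth_affine_real] smooth_cos)
  then have sm: "smooth H" by (simp add: H_def[abs_def] diff_divide_distrib)
  moreover have "H (y + 2 * pi) = H y" for y by (simp add: H_def)
  moreover have rng: "0 \<le> H y" "H y \<le> 1" for y using h(2,3) by (auto simp: H_def)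
  moreover have "(H has_integral 2 * pi * \<theta>) {0..2 * pi}"
  proof -
    have "H integrable_on {0..2 * pi}"
      by (intro integrable_continuous_real smooth_continuous_on sm)
    then have "(H has_integral T c) {0..2 * pi}"
      unfolding T_def H_def by (rule integrable_integral)
    then show ?thesis using c(3) by simp
  qed
  moreover have "integral {0..2 * pi} (\<lambda>y. H y * (1 - H y)) < \<epsilon>"
  proof -
    have "integral {0..2 * pi} (\<lambda>y. H y * (1 - H y))
        \<le> 2 * (arccos (max (- 1) c) - arccos (min 1 (c + \<tau>)))"
    proof (rule integral_cos_window_le)
      show "continuous_on {0..2 * pi} (\<lambda>y. H y * (1 - H y))"
        by (intro continuous_intros smooth_continuous_on sm)
      show "H y * (1 - H y) \<le> 1" for y
        using mult_le_one[of "H y" "1 - H y"] rng[of y] by simp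
      fix y
      assume nz: "H y * (1 - H y) \<noteq> 0"
      have "0 < (cos y - c) / \<tau>" using nz h(4) unfolding H_def by (metis linorder_not_le mult_zero_left)
      moreover have "(cos y - c) / \<tau> < 1"
        using nz h(5) unfolding H_def by (metis cancel_comm_monoid_add_class.diff_cancel linorder_not_le mult_zero_right)
      ultimately show "c < cos y \<and> cos y < c + \<tau>" using \<tau> by (simp add: field_simps)
    qed (use rng c \<tau> in auto)
    moreover have "dist (arccos (max (- 1) c)) (arccos (min 1 (c + \<tau>))) < \<epsilon> / 2"
      by (intro d(2)) (use c \<tau> in \<open>auto simp: dist_real_def min_def max_def\<close>)
    ultimately show ?thesis unfolding dist_real_def by (smt (verit) field_sum_of_halves)
  qed
  ultimately show ?thesis by (rule that)
qed

text \<open>The second derivative \<open>g\<close> of the profile \<open>F\<close> oscillates between \<open>s1\<close> and \<open>s2\<close>. The weight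
  \<open>(s2 - g) (g - s1)\<close>, which vanishes exactly where \<open>g\<close> is at one of the two ends, has a small mean \<open>m\<close>.
  The bounded function \<open>J\<close> serves to integrate the weight at high frequency by the fundamental theorem
  of calculus, without counting periods.\<close>

lemma oscillation_profile:
  fixes s1 s2 \<epsilon> :: real
  assumes s: "s1 < 0" "0 < s2" and \<epsilon>: "\<epsilon> > 0"
  obtains F F' g J B m where "smooth F" "\<And>y. (F has_real_derivative F' y) (at y)"
    "\<And>y. (F' has_real_derivative g y) (at y)" "smooth g" "\<And>y. s1 \<le> g y" "\<And>y. g y \<le> s2"
    "\<And>y. (J has_real_derivative (s2 - g y) * (g y - s1) - m) (at y)" "m < \<epsilon>" "B > 0"
    "\<And>y. \<bar>F y\<bar> \<le> B" "\<And>y. \<bar>F' y\<bar> \<le> B" "\<And>y. \<bar>J y\<bar> \<le> B"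
proof -
  define L where "L = s2 - s1"
  \<comment> \<open>The fraction of a period to be spent at \<open>s2\<close> in order that \<open>g\<close> has mean zero.\<close>
  define \<theta> where "\<theta> = - s1 / L"
  have L: "L > 0" using s by (simp add: L_def)
  have \<theta>: "0 < \<theta>" "\<theta> < 1" using s L by (auto simp: \<theta>_def L_def field_simps)
  have pos: "\<epsilon> * (2 * pi) / L\<^sup>2 > 0" using \<epsilon> L by simp
  obtain H :: "real \<Rightarrow> real" where H: "smooth H"
    "\<And>y. H (y + 2 * pi) = H y" "\<And>y. 0 \<le> H y" "\<And>y. H y \<le> 1"
    and mean: "(H has_integral 2 * pi * \<theta>) {0..2 * pi}"
    and small: "integral {0..2 * pi} (\<lambda>y. H y * (1 - H y)) < \<epsilon> * (2 * pi) / L\<^sup>2"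
    by (rule smooth_periodic_switch[OF \<theta> pos]) (rule that)
  define g where "g y = s1 + L * H y" for y
  have g: "smooth g"
    unfolding g_def by (intro smooth_add smooth_mult smooth_const H)
  have gper: "g (y + 2 * pi) = g y" for y by (simp add: g_def H)
  have g0: "(g has_integral 2 * pi * 0) {0..2 * pi}"
  proof -
    have "(g has_integral (2 * pi * s1 + L * (2 * pi * \<theta>))) {0..2 * pi}"
      unfolding g_def
      by (intro has_integral_add has_integral_mult_right mean has_integral_const_2pi)
    also have "2 * pi * s1 + L * (2 * pi * \<theta>) = 2 * pi * 0"
      using L by (simp add: \<theta>_def algebra_simps)
    finally show ?thesis .
  qed
  obtain F1 B1 where F1: "\<And>y. (F1 has_real_derivative g y - 0) (at y)" "\<And>y. F1 (y + 2 * pi) = F1 y"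
    "B1 > 0" "\<And>y. \<bar>F1 y\<bar> \<le> B1"
    using periodic_2pi_antiderivative[OF smooth_continuous_on[OF g] gper g0] by metis
  have smF1: "smooth F1" by (rule smooth_antiderivative[OF F1(1)]) (simp add: g)
  \<comment> \<open>The first antiderivative is shifted by its own mean, so that the second one is bounded too.\<close>
  define a where "a = integral {0..2 * pi} F1 / (2 * pi)"
  have "(F1 has_integral 2 * pi * a) {0..2 * pi}"
    unfolding a_def using integrable_integral[OF integrable_continuous_real[OF smooth_continuous_on[OF smF1]]]
    by simp
  then obtain F B0 where F: "\<And>y. (F has_real_derivative F1 y - a) (at y)"
    "B0 > 0" "\<And>y. \<bar>F y\<bar> \<le> B0"
    using periodic_2pi_antiderivative[OF smooth_continuous_on[OF smF1] F1(2)] by metis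
  define K where "K y = (s2 - g y) * (g y - s1)" for y
  have K: "K y = L\<^sup>2 * (H y * (1 - H y))" for y
    by (simp add: K_def g_def L_def power2_eq_square algebra_simps)
  have smK: "smooth K" unfolding K_def by (intro smooth_mult smooth_diff smooth_const g)
  define m where "m = integral {0..2 * pi} K / (2 * pi)"
  have "(K has_integral 2 * pi * m) {0..2 * pi}"
    unfolding m_def using integrable_integral[OF integrable_continuous_real[OF smooth_continuous_on[OF smK]]]
    by simp
  moreover have "K (y + 2 * pi) = K y" for y by (simp add: K_def gper)
  ultimately obtain J B2 where J: "\<And>y. (J has_real_derivative K y - m) (at y)"
    "B2 > 0" "\<And>y. \<bar>J y\<bar> \<le> B2"
    using periodic_2pi_antiderivative[OF smooth_continuous_on[OF smK]] by metis
  have "K = (\<lambda>y. L\<^sup>2 * (H y * (1 - H y)))" by (rule ext) (rule K)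
  then have "integral {0..2 * pi} K = L\<^sup>2 * integral {0..2 * pi} (\<lambda>y. H y * (1 - H y))"
    by (simp only: integral_mult_right)
  also have "\<dots> < L\<^sup>2 * (\<epsilon> * (2 * pi) / L\<^sup>2)"
    using small L by (intro mult_strict_left_mono) auto
  finally have "m < \<epsilon>" using L by (simp add: m_def pos_divide_less_eq)
  define B where "B = B0 + (B1 + \<bar>a\<bar>) + B2"
  show ?thesis
  proof (rule that[of F "\<lambda>y. F1 y - a" g J m B])
    show "smooth F" by (rule smooth_antiderivative[OF F(1)]) (intro smooth_diff smF1 smooth_const)
    show "((\<lambda>y. F1 y - a) has_real_derivative g y) (at y)" for y
      using DERIV_diff[OF F1(1)[of y] DERIV_const[of a]] by simp
    show "s1 \<le> g y" for y using H(3)[of y] L by (simp add: g_def)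
    show "g y \<le> s2" for y
    proof -
      have "L * H y \<le> L * 1" using H(4)[of y] L by (intro mult_left_mono) auto
      then show ?thesis unfolding g_def using L_def by linarith
    qed
    show "\<bar>F1 y - a\<bar> \<le> B" for y
      unfolding B_def using F1(4)[of y] F(2) J(2) by linarith
    show "\<bar>F y\<bar> \<le> B" "\<bar>J y\<bar> \<le> B" for y
      unfolding B_def using F(3)[of y] J(3)[of y] F(2) F1(3) J(2) by linarith+
    show "(J has_real_derivative (s2 - g y) * (g y - s1) - m) (at y)" for y
      using J(1)[of y] by (simp add: K_def)
    show "B > 0" using F(2) F1(3) J(2) by (simp add: B_def add_pos_nonneg)
  qed (use g F \<open>m < \<epsilon>\<close> in auto)
qed

section \<open>Derivatives in space and in time\<close>

lemma Ck_compose_affine: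
  assumes L: "bounded_linear L" and "Ck k f"
  shows "Ck k (\<lambda>x. f (L x + a))"
  using assms(2)
proof (induction k arbitrary: f)
  case 0
  have "continuous_on UNIV (\<lambda>x. L x + a)"
    by (intro continuous_intros linear_continuous_on L)
  then show ?case using 0 by (auto intro: continuous_on_compose2)
next
  case (Suc k)
  obtain f' where f': "\<And>x. (f has_derivative f' x) (at x)" "\<And>v. Ck k (\<lambda>x. f' x v)"
    by (rule Ck_SucE[OF Suc.prems]) (rule that)
  have "((\<lambda>x. L x + a) has_derivative L) (at x)" for x
    using has_derivative_add_const[OF bounded_linear_imp_has_derivative[OF L]] .
  then show ?case
    by (rule Ck_SucI[where f'="\<lambda>x v. f' (L x + a) (L v)", OF has_derivative_compose[OF _ f'(1)]])
      (rule Suc.IH[OF f'(2)])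
qed

lemma has_derivative_slice_x:
  assumes "smooth f"
  shows "((\<lambda>x. f (x, t)) has_derivative (\<lambda>v. dir_deriv (v, 0) f (x, t))) (at x)"
  by (rule has_derivative_compose[OF _ smooth_has_derivative[OF assms]])
    (auto intro!: derivative_eq_intros)

lemma smooth_slice_x: "smooth f \<Longrightarrow> smooth (\<lambda>x. f (x, t))"
  using Ck_compose_affine[OF bounded_linear_Pair[OF bounded_linear_ident bounded_linear_zero], of _ f "(0, t)"]
  by (simp add: smooth_def)

lemma partial_x_eq_dir_deriv:
  assumes "smooth f"
  shows "partial_x f i z = dir_deriv (axis i 1, 0) f z"
  using frechet_derivative_at[OF has_derivative_slice_x[OF assms, of "snd z" "fst z"]]
  by (simp add: partial_x_def fun_eq_iff)

lemma deriv_t_eq_dir_deriv: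
  assumes "smooth f"
  shows "deriv_t f z = dir_deriv (0, 1) f z"
proof -
  have "((\<lambda>t. f (fst z, t)) has_derivative (\<lambda>h. dir_deriv (0, h) f (fst z, snd z))) (at (snd z))"
    by (rule has_derivative_compose[OF _ smooth_has_derivative[OF assms]])
      (auto intro!: derivative_eq_intros)
  moreover have "(\<lambda>h. dir_deriv (0, h) f (fst z, snd z)) = (\<lambda>h. h *\<^sub>R dir_deriv (0, 1) f z)"
  proof (rule ext)
    show "dir_deriv (0, h) f (fst z, snd z) = h *\<^sub>R dir_deriv (0, 1) f z" for h
      using linear_cmul[OF linear_dir_deriv[OF assms, of z], of h "(0, 1)"] by simp
  qed
  ultimately have "((\<lambda>t. f (fst z, t)) has_vector_derivative dir_deriv (0, 1) f z) (at (snd z))"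
    by (simp only: has_vector_derivative_def)
  then show ?thesis unfolding deriv_t_def by (rule vector_derivative_at)
qed

lemma sum_dir_deriv_axis:
  fixes f :: "(real ^ 'n) \<times> real \<Rightarrow> real"
  assumes "smooth f"
  shows "(\<Sum>i\<in>UNIV. v $ i * dir_deriv (axis i 1, 0) f z) = dir_deriv (v, 0) f z"
proof -
  have "(v, 0 :: real) = (\<Sum>i\<in>UNIV. v $ i *\<^sub>R (axis i 1, 0))"
  proof (rule prod_eqI)
    have "v = (\<Sum>i\<in>UNIV. v $ i *\<^sub>R axis i 1)"
      by (rule basis_expansion[of v, symmetric, unfolded scalar_mult_eq_scaleR])
    then show "fst (v, 0 :: real) = fst (\<Sum>i\<in>UNIV. v $ i *\<^sub>R (axis i 1, 0))"
      by (simp only: fst_sum scaleR_Pair fst_conv)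
  qed (simp add: snd_sum)
  then have "dir_deriv (v, 0) f z = (\<Sum>i\<in>UNIV. dir_deriv (v $ i *\<^sub>R (axis i 1, 0)) f z)"
    by (simp only: linear_sum[OF linear_dir_deriv[OF assms]])
  then show ?thesis by (simp only: linear_cmul[OF linear_dir_deriv[OF assms]] real_scaleR_def)
qed

text \<open>For every scalar function \<open>u\<close> the field \<open>(D\<^sub>q u) \<gamma> - (D\<^sub>\<gamma> u) q\<close> is divergence free: it is the
  divergence of an antisymmetric matrix field.\<close>

lemma div_x_antisymmetric:
  fixes u :: "(real ^ 'n) \<times> real \<Rightarrow> real"
  assumes u: "smooth u"
  shows "div_x (\<lambda>z. c *\<^sub>R (dir_deriv (q, 0) u z *\<^sub>R \<gamma> - dir_deriv (\<gamma>, 0) u z *\<^sub>R q)) z = 0"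
proof -
  let ?D = "\<lambda>v. dir_deriv (v, 0) u"
  have sm: "smooth (?D v)" for v by (rule smooth_dir_deriv[OF u])
  have sm2: "smooth (\<lambda>z. ?D v z *\<^sub>R w)" for v w by (intro smooth_scaleR sm smooth_const)
  have sm3: "smooth (\<lambda>z. c *\<^sub>R (?D q z *\<^sub>R \<gamma> - ?D \<gamma> z *\<^sub>R q))"
    by (intro smooth_scaleR smooth_const smooth_diff sm sm2)
  have "dir_deriv e (\<lambda>z. c *\<^sub>R (?D q z *\<^sub>R \<gamma> - ?D \<gamma> z *\<^sub>R q)) z
      = c *\<^sub>R (dir_deriv e (?D q) z *\<^sub>R \<gamma> - dir_deriv e (?D \<gamma>) z *\<^sub>R q)" for e
    by (subst dir_deriv_linear_image[OF bounded_linear_scaleR_right])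
      (simp_all add: dir_deriv_diff sm2 smooth_diff
        dir_deriv_linear_image[OF bounded_linear_scaleR_left sm])
  then have "div_x (\<lambda>z. c *\<^sub>R (?D q z *\<^sub>R \<gamma> - ?D \<gamma> z *\<^sub>R q)) z
      = (\<Sum>i\<in>UNIV. c * (\<gamma> $ i * dir_deriv (axis i 1, 0) (?D q) z - q $ i * dir_deriv (axis i 1, 0) (?D \<gamma>) z))"
    unfolding div_x_def partial_x_eq_dir_deriv[OF sm3] by (simp add: mult.commute)
  also have "\<dots> = c * (dir_deriv (\<gamma>, 0) (?D q) z - dir_deriv (q, 0) (?D \<gamma>) z)"
    by (simp add: sum_distrib_left[symmetric] sum_subtractf sum_dir_deriv_axis[OF sm])
  also have "\<dots> = 0" by (simp add: dir_deriv_commute[OF u, of "(\<gamma>, 0)"])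
  finally show ?thesis .
qed

section \<open>Functions of compact support\<close>

lemma Cc_inftyI:
  assumes "smooth f" "compact C" "C \<subseteq> \<Omega>" "\<And>z. z \<notin> C \<Longrightarrow> f z = 0"
  shows "f \<in> Cc_infty \<Omega>"
proof -
  have "closure {z. f z \<noteq> 0} \<subseteq> C"
    using assms(2,4) by (intro closure_minimal) (auto simp: compact_imp_closed)
  moreover from this have "compact (closure {z. f z \<noteq> 0})"
    using assms(2) closed_closure by (metis compact_Int_closed inf.absorb_iff2)
  ultimately show ?thesis using assms(1,3) by (auto simp: Cc_infty_def smooth_def)
qed

lemma compact_support_bounded:
  fixes f :: "'a::euclidean_space \<Rightarrow> real"
  assumes "smooth f" "compact C" "\<And>z. z \<notin> C \<Longrightarrow> f z = 0"
  shows "\<exists>M>0. \<forall>z. \<bar>f z\<bar> \<le> M"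
proof -
  have "compact (f ` C)"
    by (intro compact_continuous_image smooth_continuous_on assms)
  then obtain M where M: "M > 0" "\<And>z. z \<in> C \<Longrightarrow> \<bar>f z\<bar> \<le> M"
    using compact_imp_bounded bounded_pos by (metis (no_types, lifting) image_eqI real_norm_def)
  have "\<bar>f z\<bar> \<le> M" for z
    using M assms(3)[of z] by (cases "z \<in> C") auto
  with M(1) show ?thesis by blast
qed

lemma compact_support_integrable:
  fixes f :: "'a::euclidean_space \<Rightarrow> real"
  assumes "smooth f" "compact C" "\<And>z. z \<notin> C \<Longrightarrow> f z = 0"
  shows "integrable lborel f"
proof -
  have "integrable lborel (\<lambda>x. indicator C x *\<^sub>R f x)"
    by (rule borel_integrable_compact[OF assms(2) smooth_continuous_on[OF assms(1)]])
  moreover have "(\<lambda>x. indicator C x *\<^sub>R f x) = f"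
    using assms(3) by (auto simp: indicator_def fun_eq_iff)
  ultimately show ?thesis by simp
qed

text \<open>The difference quotients of \<open>u\<close> have integral zero by translation invariance, and converge
  dominatedly to the derivative.\<close>

lemma integral_dir_deriv_eq_0:
  fixes u :: "'a::euclidean_space \<Rightarrow> real"
  assumes u: "smooth u" and C: "compact C" "\<And>z. z \<notin> C \<Longrightarrow> u z = 0"
  shows "integral\<^sup>L lborel (dir_deriv q u) = 0"
proof -
  define h where "h n = inverse (real (Suc n))" for n
  have h: "0 < h n" "h n \<le> 1" for n by (auto simp: h_def field_simps)
  define s where "s n x = (u (x + h n *\<^sub>R q) - u x) / h n" for n x
  have int_u: "integrable lborel u" by (rule compact_support_integrable[OF u C])
  have meas: "u \<in> borel_measurable borel"
    by (intro borel_measurable_continuous_onI smooth_continuous_on u)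
  have trans: "integrable lborel (\<lambda>x. u (x + a))" "integral\<^sup>L lborel (\<lambda>x. u (x + a)) = integral\<^sup>L lborel u" for a
    using integrable_distr_eq[of "(+) a" lborel borel u] integral_distr[of "(+) a" lborel borel u] meas int_u
    by (simp_all add: lborel_distr_plus add.commute)
  have s0: "integral\<^sup>L lborel (s n) = 0" for n
    unfolding s_def using trans int_u by simp
  obtain M where M: "M > 0" "\<And>z. \<bar>dir_deriv q u z\<bar> \<le> M"
    using compact_support_bounded[OF smooth_dir_deriv[OF u] C(1)
        dir_deriv_eq_0[OF compact_imp_closed[OF C(1)] C(2)]] by blast
  obtain R where R: "\<And>z. z \<in> C \<Longrightarrow> norm z \<le> R"
    using compact_imp_bounded[OF C(1)] unfolding bounded_iff by blast
  have "(\<lambda>n. integral\<^sup>L lborel (s n)) \<longlonglongrightarrow> integral\<^sup>L lborel (dir_deriv q u)"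
  proof (rule integral_dominated_convergence)
    show "dir_deriv q u \<in> borel_measurable lborel"
      by (auto intro!: borel_measurable_continuous_onI smooth_continuous_on smooth_dir_deriv u)
    show "s n \<in> borel_measurable lborel" for n
      unfolding s_def using trans(1) int_u by measurable
    show "integrable lborel (\<lambda>x. M * indicator (cball 0 (R + norm q)) x :: real)"
      by (intro integrable_mult_right integrable_real_indicator) (use emeasure_bounded_finite[of "cball 0 (R + norm q)"] in auto)
    show "AE x in lborel. norm (s n x) \<le> M * indicator (cball 0 (R + norm q)) x" for n
    proof (rule AE_I2)
      fix x
      show "norm (s n x) \<le> M * indicator (cball 0 (R + norm q)) x"
      proof (cases "norm x \<le> R + norm q")
        case True
        obtain \<xi> where "u (x + h n *\<^sub>R q) - u (x + 0 *\<^sub>R q) = (h n - 0) * dir_deriv q u (x + \<xi> *\<^sub>R q)"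
          using MVT2[OF h(1) DERIV_dir_deriv[OF u]] by blast
        then have "s n x = dir_deriv q u (x + \<xi> *\<^sub>R q)"
          using h(1)[of n] by (simp add: s_def)
        then show ?thesis using True M(2) by simp
      next
        case False
        have "norm (x + h n *\<^sub>R q) \<ge> norm x - norm (h n *\<^sub>R q)" by (rule norm_diff_ineq)
        moreover have "norm (h n *\<^sub>R q) \<le> 1 * norm q"
          unfolding norm_scaleR using h[of n] by (intro mult_right_mono) auto
        ultimately have "x + h n *\<^sub>R q \<notin> C" using R False by fastforce
        moreover have "x \<notin> C" using R[of x] False norm_ge_zero[of q] by linarith
        ultimately have "s n x = 0" using C(2) by (simp add: s_def)
        then show ?thesis using M(1) by simp
      qed
    qed
    show "AE x in lborel. (\<lambda>n. s n x) \<longlonglongrightarrow> dir_deriv q u x"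
    proof (rule AE_I2)
      fix x
      have "((\<lambda>t. (u (x + t *\<^sub>R q) - u x) / t) \<longlongrightarrow> dir_deriv q u x) (at 0)"
        using DERIV_dir_deriv[OF u, of x q 0] by (simp add: has_field_derivative_iff)
      moreover have "filterlim h (at 0) sequentially"
        using LIMSEQ_inverse_real_of_nat h(1)
        by (auto simp: filterlim_at h_def[abs_def] intro!: always_eventually)
      ultimately show "(\<lambda>n. s n x) \<longlonglongrightarrow> dir_deriv q u x"
        unfolding s_def by (rule filterlim_compose)
    qed
  qed
  then show ?thesis by (simp add: s0 LIMSEQ_const_iff)
qed

text \<open>Leading order of the derivatives of a ridge function \<open>z \<mapsto> F (N (l \<bullet> z))\<close> with a cutoff,
  as the frequency \<open>N\<close> tends to infinity.\<close>

lemma dir_deriv_ridge_cutoff: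
  fixes \<zeta> :: "'a::euclidean_space \<Rightarrow> real" and F F' g :: "real \<Rightarrow> real" and l :: 'a
  assumes \<zeta>: "smooth \<zeta>" "\<And>z. 0 \<le> \<zeta> z" "\<And>z. \<zeta> z \<le> 1" "compact C" "\<And>z. z \<notin> C \<Longrightarrow> \<zeta> z = 0"
    and F: "smooth F" "\<And>y. (F has_real_derivative F' y) (at y)"
      "\<And>y. (F' has_real_derivative g y) (at y)" "smooth g"
    and B: "\<And>y. \<bar>F y\<bar> \<le> B" "\<And>y. \<bar>F' y\<bar> \<le> B"
  defines "u \<equiv> \<lambda>N z. \<zeta> z * F (N * (l \<bullet> z))"
  shows "\<exists>K>0. \<forall>N\<ge>1. \<forall>z. \<bar>dir_deriv v (u N) z\<bar> \<le> K * N \<and>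
    \<bar>dir_deriv w (dir_deriv v (u N)) z - N\<^sup>2 * (l \<bullet> v) * (l \<bullet> w) * (\<zeta> z * g (N * (l \<bullet> z)))\<bar> \<le> K * N"
proof -
  have smF': "smooth F'" by (rule smooth_antiderivative[OF F(3,4)])
  have ridge: "smooth (\<lambda>z. f (N * (l \<bullet> z)))" if "smooth f" for f :: "real \<Rightarrow> real" and N
    by (intro smooth_compose_real[OF that] smooth_mult smooth_const smooth_bounded_linear
        bounded_linear_inner_right)
  let ?D = "dir_deriv"
  have cl: "closed C" by (rule compact_imp_closed[OF \<zeta>(4)])
  have supp: "?D v \<zeta> z = 0" "?D w (?D v \<zeta>) z = 0" if "z \<notin> C" for v w z
    using dir_deriv_eq_0[OF cl, of \<zeta>] dir_deriv_eq_0[OF cl, of "?D v \<zeta>"] \<zeta>(5) that by blast+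
  obtain Mv where Mv: "Mv > 0" "\<And>z. \<bar>?D v \<zeta> z\<bar> \<le> Mv"
    using compact_support_bounded[OF smooth_dir_deriv[OF \<zeta>(1)] \<zeta>(4) supp(1)] by blast
  obtain Mw where Mw: "Mw > 0" "\<And>z. \<bar>?D w \<zeta> z\<bar> \<le> Mw"
    using compact_support_bounded[OF smooth_dir_deriv[OF \<zeta>(1)] \<zeta>(4) supp(1)] by blast
  obtain M2 where M2: "M2 > 0" "\<And>z. \<bar>?D w (?D v \<zeta>) z\<bar> \<le> M2"
    using compact_support_bounded[OF smooth_dir_deriv[OF smooth_dir_deriv[OF \<zeta>(1)]] \<zeta>(4) supp(2)] by blast
  have D1: "?D v (u N) = (\<lambda>z. (N * (l \<bullet> v)) * (\<zeta> z * F' (N * (l \<bullet> z))) + ?D v \<zeta> z * F (N * (l \<bullet> z)))" for N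
    unfolding u_def
    by (rule ext) (simp add: dir_deriv_mult[OF \<zeta>(1) ridge[OF F(1)]] dir_deriv_ridge[OF F(2)])
  have D2: "?D w (?D v (u N)) z - N\<^sup>2 * (l \<bullet> v) * (l \<bullet> w) * (\<zeta> z * g (N * (l \<bullet> z)))
     = N * (((l \<bullet> v) * ?D w \<zeta> z + (l \<bullet> w) * ?D v \<zeta> z) * F' (N * (l \<bullet> z))) + ?D w (?D v \<zeta>) z * F (N * (l \<bullet> z))" for N z
  proof -
    have sm1: "smooth (\<lambda>z. \<zeta> z * F' (N * (l \<bullet> z)))" by (intro smooth_mult \<zeta>(1) ridge smF')
    have sm2: "smooth (\<lambda>z. ?D v \<zeta> z * F (N * (l \<bullet> z)))"
      by (intro smooth_mult smooth_dir_deriv \<zeta>(1) ridge F(1))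
    have "?D w (?D v (u N)) z = (N * (l \<bullet> v)) * ?D w (\<lambda>z. \<zeta> z * F' (N * (l \<bullet> z))) z
        + ?D w (\<lambda>z. ?D v \<zeta> z * F (N * (l \<bullet> z))) z"
      unfolding D1 by (subst dir_deriv_add)
        (use dir_deriv_linear_image[OF bounded_linear_mult_right sm1] sm1 sm2 in \<open>auto intro: smooth_mult\<close>)
    then show ?thesis
      by (simp add: dir_deriv_mult[OF \<zeta>(1) ridge[OF smF']] dir_deriv_ridge[OF F(3)]
          dir_deriv_mult[OF smooth_dir_deriv[OF \<zeta>(1)] ridge[OF F(1)]] dir_deriv_ridge[OF F(2)]
          algebra_simps power2_eq_square)
  qed
  have B0: "B \<ge> 0" using B(1)[of 0] by linarith
  define K where "K = 1 + (\<bar>l \<bullet> v\<bar> + Mv) * B + (\<bar>l \<bullet> v\<bar> * Mw + \<bar>l \<bullet> w\<bar> * Mv) * B + M2 * B"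
  have K: "K > 0" unfolding K_def using Mv Mw M2 B0 by (intro add_pos_nonneg add_nonneg_nonneg mult_nonneg_nonneg) auto
  show ?thesis
  proof (intro exI[of _ K] conjI K allI impI)
    fix N :: real and z :: 'a
    assume N: "1 \<le> N"
    have le1: "X \<le> X * N" if "X \<ge> 0" for X using mult_left_mono[OF N that] by simp
    have zF': "\<bar>\<zeta> z * F' y\<bar> \<le> B" for y
      unfolding abs_mult using mult_mono[of "\<bar>\<zeta> z\<bar>" 1 "\<bar>F' y\<bar>" B] \<zeta>(2,3)[of z] B(2)[of y] by simp
    have vF: "\<bar>?D v \<zeta> z * F y\<bar> \<le> Mv * B" for y
      unfolding abs_mult by (intro mult_mono Mv B) (use Mv in auto)
    have wF: "\<bar>?D w (?D v \<zeta>) z * F y\<bar> \<le> M2 * B" for y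
      unfolding abs_mult by (intro mult_mono M2 B) (use M2 in auto)
    have "\<bar>?D v (u N) z\<bar> \<le> N * (\<bar>l \<bullet> v\<bar> * B) + Mv * B"
    proof -
      have "\<bar>(N * (l \<bullet> v)) * (\<zeta> z * F' (N * (l \<bullet> z)))\<bar> \<le> (N * \<bar>l \<bullet> v\<bar>) * B"
        unfolding abs_mult[of "N * (l \<bullet> v)"] using N by (intro mult_mono zF') (auto simp: abs_mult)
      then show ?thesis unfolding D1 using vF[of "N * (l \<bullet> z)"] by (simp add: mult.assoc)
    qed
    also have "\<dots> \<le> N * (\<bar>l \<bullet> v\<bar> * B) + Mv * B * N" using le1[of "Mv * B"] Mv B0 by simp
    also have "\<dots> \<le> K * N"
      using N B0 Mv Mw M2 unfolding K_def by (simp add: algebra_simps)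
    finally show "\<bar>?D v (u N) z\<bar> \<le> K * N" .
    have "\<bar>((l \<bullet> v) * ?D w \<zeta> z + (l \<bullet> w) * ?D v \<zeta> z) * F' (N * (l \<bullet> z))\<bar> \<le> (\<bar>l \<bullet> v\<bar> * Mw + \<bar>l \<bullet> w\<bar> * Mv) * B"
      unfolding abs_mult
    proof (intro mult_mono B)
      have "\<bar>(l \<bullet> v) * ?D w \<zeta> z\<bar> \<le> \<bar>l \<bullet> v\<bar> * Mw" "\<bar>(l \<bullet> w) * ?D v \<zeta> z\<bar> \<le> \<bar>l \<bullet> w\<bar> * Mv"
        unfolding abs_mult by (auto intro!: mult_left_mono Mv Mw)
      then show "\<bar>(l \<bullet> v) * ?D w \<zeta> z + (l \<bullet> w) * ?D v \<zeta> z\<bar> \<le> \<bar>l \<bullet> v\<bar> * Mw + \<bar>l \<bullet> w\<bar> * Mv"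
        by linarith
    qed (use Mv Mw in auto)
    then have "\<bar>N * (((l \<bullet> v) * ?D w \<zeta> z + (l \<bullet> w) * ?D v \<zeta> z) * F' (N * (l \<bullet> z)))\<bar>
        \<le> N * ((\<bar>l \<bullet> v\<bar> * Mw + \<bar>l \<bullet> w\<bar> * Mv) * B)"
      unfolding abs_mult[of N] using N by (intro mult_mono) auto
    then have "\<bar>?D w (?D v (u N)) z - N\<^sup>2 * (l \<bullet> v) * (l \<bullet> w) * (\<zeta> z * g (N * (l \<bullet> z)))\<bar>
        \<le> N * ((\<bar>l \<bullet> v\<bar> * Mw + \<bar>l \<bullet> w\<bar> * Mv) * B) + M2 * B"
      unfolding D2 using wF[of "N * (l \<bullet> z)"] by linarith
    also have "\<dots> \<le> N * ((\<bar>l \<bullet> v\<bar> * Mw + \<bar>l \<bullet> w\<bar> * Mv) * B) + M2 * B * N"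
      using le1[of "M2 * B"] M2 B0 by simp
    also have "\<dots> \<le> K * N"
      using N B0 Mv Mw M2 unfolding K_def by (simp add: algebra_simps)
    finally show "\<bar>?D w (?D v (u N)) z - N\<^sup>2 * (l \<bullet> v) * (l \<bullet> w) * (\<zeta> z * g (N * (l \<bullet> z)))\<bar> \<le> K * N" .
  qed
qed

text \<open>A bound on the integral over every line in the \<open>t\<close>-direction bounds the integral over the product.\<close>

lemma integral_box_product_le:
  fixes G :: "'a::euclidean_space \<times> real \<Rightarrow> real"
  assumes G: "continuous_on UNIV G" "\<And>z. 0 \<le> G z" and M: "0 \<le> M"
    and strip: "\<And>x. (\<integral>\<^sup>+t. ennreal (G (x, t)) * indicator {a..b} t \<partial>lborel) \<le> ennreal M"
  shows "(LINT z:(box c d \<times> box a b)|lborel. G z) \<le> measure lborel (box c d) * M"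
proof -
  let ?S = "box c d \<times> box a b"
  have [measurable]: "G \<in> borel_measurable borel" by (rule borel_measurable_continuous_onI[OF G(1)])
  have [measurable]: "?S \<in> sets borel" by (intro borel_open open_Times) auto
  have m: "(\<lambda>z. indicator ?S z *\<^sub>R G z) \<in> borel_measurable lborel" by measurable
  have m2: "(\<lambda>z. ennreal (indicator ?S z *\<^sub>R G z)) \<in> borel_measurable (lborel \<Otimes>\<^sub>M lborel)"
    unfolding lborel_prod by measurable
  have eq: "(LINT z:?S|lborel. G z) = enn2real (\<integral>\<^sup>+z. ennreal (indicator ?S z *\<^sub>R G z) \<partial>lborel)"
    unfolding set_lebesgue_integral_def
    by (rule integral_eq_nn_integral[OF m]) (simp add: G)
  have "(\<integral>\<^sup>+z. ennreal (indicator ?S z *\<^sub>R G z) \<partial>lborel)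
      = (\<integral>\<^sup>+z. ennreal (indicator ?S z *\<^sub>R G z) \<partial>(lborel \<Otimes>\<^sub>M lborel))"
    by (simp add: lborel_prod)
  also have "\<dots> = (\<integral>\<^sup>+x. \<integral>\<^sup>+t. ennreal (indicator ?S (x, t) *\<^sub>R G (x, t)) \<partial>lborel \<partial>lborel)"
    by (rule lborel.nn_integral_fst[OF m2, symmetric])
  also have "\<dots> \<le> (\<integral>\<^sup>+x. ennreal M * indicator (box c d) x \<partial>lborel)"
  proof (rule nn_integral_mono)
    fix x :: 'a
    have "(\<integral>\<^sup>+t. ennreal (indicator ?S (x, t) *\<^sub>R G (x, t)) \<partial>lborel)
        \<le> (\<integral>\<^sup>+t. indicator (box c d) x * (ennreal (G (x, t)) * indicator {a..b} t) \<partial>lborel)"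
      by (rule nn_integral_mono) (auto simp: indicator_def)
    also have "\<dots> = indicator (box c d) x * (\<integral>\<^sup>+t. (ennreal (G (x, t)) * indicator {a..b} t) \<partial>lborel)"
      by (rule nn_integral_cmult) measurable
    also have "\<dots> \<le> indicator (box c d) x * ennreal M"
      by (intro mult_left_mono strip) auto
    finally show "(\<integral>\<^sup>+t. ennreal (indicator ?S (x, t) *\<^sub>R G (x, t)) \<partial>lborel)
        \<le> ennreal M * indicator (box c d) x" by (simp add: mult.commute)
  qed
  also have "\<dots> = ennreal (M * measure lborel (box c d))"
  proof -
    have "emeasure lborel (box c d) = ennreal (measure lborel (box c d))"
      by (rule emeasure_eq_ennreal_measure) (use emeasure_lborel_box_finite[of c d] in auto)
    moreover have "box c d \<in> sets lborel" by simp
    ultimately show ?thesis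
      by (simp only: nn_integral_cmult_indicator ennreal_mult M measure_nonneg)
  qed
  finally have "(\<integral>\<^sup>+z. ennreal (indicator ?S z *\<^sub>R G z) \<partial>lborel) \<le> ennreal (M * measure lborel (box c d))" .
  then have "enn2real (\<integral>\<^sup>+z. ennreal (indicator ?S z *\<^sub>R G z) \<partial>lborel) \<le> M * measure lborel (box c d)"
    using enn2real_mono M by fastforce
  with eq show ?thesis by (simp only: mult.commute)
qed

lemma set_integrable_box:
  fixes f :: "'a::euclidean_space \<Rightarrow> real"
  assumes "continuous_on UNIV f"
  shows "set_integrable lborel (box x y) f"
proof -
  have "set_integrable lborel (cbox x y) f"
    unfolding set_integrable_def
    by (intro borel_integrable_compact continuous_on_subset[OF assms]) auto
  then show ?thesis by (rule set_integrable_subset) (auto simp: box_subset_cbox)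
qed

lemma box_Pair_eq: "box (c, a) (d, b) = box c d \<times> box a b"
  by (force simp: box_def Basis_prod_def)

lemma measure_lborel_Times_box:
  "measure lborel (box c d \<times> box a b) = measure lborel (box c d) * measure lborel (box a b)"
  for c d :: "'a::euclidean_space" and a b :: "'b::euclidean_space"
proof -
  have "emeasure lborel (box c d \<times> box a b) = emeasure lborel (box c d) * emeasure lborel (box a b)"
    using lborel.emeasure_pair_measure_Times[of "box c d" lborel "box a b"] by (simp add: lborel_prod)
  then show ?thesis by (simp add: measure_def enn2real_mult)
qed

section \<open>Oscillation along a line segment\<close>

text \<open>The functions \<open>\<phi>\<close> and \<open>\<psi>\<close> for a segment with direction \<open>(q,\<gamma>)\<close>. The position on the segment is
  \<open>\<sigma> = \<zeta> g\<close>, with \<open>g\<close> the second derivative of the profile; it stays in \<open>[s1,s2]\<close> because that interval contains \<open>0\<close>.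
  The last inequality says that \<open>\<sigma>\<close> is mostly close to the two ends.\<close>

lemma oscillation:
  fixes q \<gamma> c d :: "real ^ 'n" and a b s1 s2 \<tau> \<rho> :: real
  assumes q: "norm q = 1" "q \<bullet> \<gamma> = 0" and s: "s1 < 0" "0 < s2"
    and Q: "box c d \<noteq> {}" and I: "a < b" and \<tau>: "\<tau> > 0" and \<rho>: "\<rho> > 0"
  obtains \<phi> :: "(real ^ 'n) \<times> real \<Rightarrow> real" and \<psi> :: "(real ^ 'n) \<times> real \<Rightarrow> real ^ 'n"
    and \<sigma> :: "(real ^ 'n) \<times> real \<Rightarrow> real" where
    "smooth \<phi>" "smooth \<psi>" "(\<lambda>z. (\<phi> z, \<psi> z)) \<in> Cc_infty (box c d \<times> box a b)"
    "\<And>z. div_x \<psi> z = 0" "\<And>t. (LINT x:box c d|lborel. \<phi> (x, t)) = 0"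
    "\<And>z. norm (\<phi> z, \<psi> z) \<le> \<rho>" "\<And>z. \<bar>deriv_t \<phi> z\<bar> \<le> \<rho>"
    "\<And>z. s1 \<le> \<sigma> z" "\<And>z. \<sigma> z \<le> s2"
    "\<And>z. norm (grad_x \<phi> z - \<sigma> z *\<^sub>R q) \<le> \<tau>" "\<And>z. norm (deriv_t \<psi> z - \<sigma> z *\<^sub>R \<gamma>) \<le> \<tau>"
    "set_integrable lborel (box c d \<times> box a b) (\<lambda>z. (s2 - \<sigma> z) * (\<sigma> z - s1))"
    "(LINT z:(box c d \<times> box a b)|lborel. (s2 - \<sigma> z) * (\<sigma> z - s1))
      \<le> \<tau> * measure lborel (box c d \<times> box a b)"
proof -
  define \<Omega> where "\<Omega> = box c d \<times> box a b"
  have \<Omega>: "\<Omega> = box (c, a) (d, b)" by (simp add: \<Omega>_def box_Pair_eq)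
  define L where "L = s2 - s1"
  have L: "L > 0" using s by (simp add: L_def)
  have mQ: "measure lborel (box c d) > 0"
    using Q by (auto simp: measure_lborel_box_eq box_ne_empty inner_diff_left intro!: prod_pos)
  have m\<Omega>: "measure lborel \<Omega> = measure lborel (box c d) * (b - a)"
    unfolding \<Omega>_def measure_lborel_Times_box using I by simp
  have m\<Omega>0: "measure lborel \<Omega> > 0" unfolding m\<Omega> using mQ I by simp
  have half: "\<tau> / 2 > 0" using \<tau> by simp
  obtain F F' g J B m where F: "smooth F" "\<And>y. (F has_real_derivative F' y) (at y)"
    "\<And>y. (F' has_real_derivative g y) (at y)" "smooth g" and g: "\<And>y. s1 \<le> g y" "\<And>y. g y \<le> s2"
    and J: "\<And>y. (J has_real_derivative (s2 - g y) * (g y - s1) - m) (at y)" and m: "m < \<tau> / 2"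
    and B: "B > 0" "\<And>y. \<bar>F y\<bar> \<le> B" "\<And>y. \<bar>F' y\<bar> \<le> B" "\<And>y. \<bar>J y\<bar> \<le> B"
    by (rule oscillation_profile[OF s half]) (rule that)
  have ne: "box (c, a) (d, b) \<noteq> {}" unfolding box_Pair_eq using Q I by (simp add: box_ne_empty)
  have slack: "\<tau> * measure lborel \<Omega> / (4 * L\<^sup>2) > 0" using \<tau> m\<Omega>0 L by simp
  obtain \<zeta> :: "(real ^ 'n) \<times> real \<Rightarrow> real" and C E where \<zeta>: "smooth \<zeta>" "\<And>z. 0 \<le> \<zeta> z" "\<And>z. \<zeta> z \<le> 1"
    "compact C" "C \<subseteq> box (c, a) (d, b)" "\<And>z. z \<notin> C \<Longrightarrow> \<zeta> z = 0"
    and E: "E \<in> sets lborel" "\<And>z. z \<in> E \<Longrightarrow> \<zeta> z = 1"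
    "measure lborel (box (c, a) (d, b) - E) \<le> \<tau> * measure lborel \<Omega> / (4 * L\<^sup>2)"
    by (rule smooth_box_cutoff[OF ne slack]) (rule that)
  \<comment> \<open>The leading term of \<open>\<phi>\<^sub>t\<close> is \<open>\<beta> \<sigma>\<close>, and \<open>\<sigma>\<close> is bounded by \<open>L\<close>.\<close>
  define \<beta> where "\<beta> = \<rho> / (2 * L)"
  have \<beta>: "\<beta> > 0" using \<rho> L by (simp add: \<beta>_def)
  define l where "l = (q, \<beta>)"
  define u where "u N z = \<zeta> z * F (N * (l \<bullet> z))" for N z
  define K where "K v w = (SOME k. k > 0 \<and> (\<forall>N\<ge>1. \<forall>z. \<bar>dir_deriv v (u N) z\<bar> \<le> k * N \<and>
    \<bar>dir_deriv w (dir_deriv v (u N)) z - N\<^sup>2 * (l \<bullet> v) * (l \<bullet> w) * (\<zeta> z * g (N * (l \<bullet> z)))\<bar> \<le> k * N))" for v w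
  have K: "K v w > 0" "N \<ge> 1 \<Longrightarrow> \<bar>dir_deriv v (u N) z\<bar> \<le> K v w * N"
    "N \<ge> 1 \<Longrightarrow> \<bar>dir_deriv w (dir_deriv v (u N)) z - N\<^sup>2 * (l \<bullet> v) * (l \<bullet> w) * (\<zeta> z * g (N * (l \<bullet> z)))\<bar> \<le> K v w * N"
    for v w N z
    using someI_ex[OF dir_deriv_ridge_cutoff[OF \<zeta>(1-4,6) F B(2,3), where v=v and w=w and l=l]]
    unfolding K_def u_def by blast+
  define e f T :: "(real ^ 'n) \<times> real" where "e = (q, 0)" and "f = (\<gamma>, 0)" and "T = (0, 1)"
  have qq: "q \<bullet> q = 1" using q(1) by (simp add: dot_square_norm)
  have l: "l \<bullet> e = 1" "l \<bullet> f = 0" "l \<bullet> T = \<beta>" "l \<bullet> (axis i 1, 0) = q $ i" for i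
    using qq q(2) by (simp_all add: l_def e_def f_def T_def inner_axis)
  \<comment> \<open>In units of \<open>1/N\<close>: \<open>A1\<close> bounds \<open>\<phi>\<close> and the error of \<open>\<phi>\<^sub>t\<close>, \<open>A2\<close> bounds \<open>\<psi>\<close> and the error of \<open>\<psi>\<^sub>t\<close>,
    \<open>A3\<close> the error of \<open>D\<phi>\<close>, and \<open>A4\<close> the boundary terms of the integral of the weight in \<open>t\<close>.\<close>
  define A1 where "A1 = K e T"
  define A2 where "A2 = (K e T * norm \<gamma> + K f T) / \<beta>"
  define A3 where "A3 = (\<Sum>i\<in>UNIV. K e (axis i 1, 0))"
  define A4 where "A4 = 2 * B / \<beta>"
  have K0: "0 \<le> K v w" for v w using K(1)[of v w] by simp
  have A: "A1 \<ge> 0" "A2 \<ge> 0" "A3 \<ge> 0" "A4 \<ge> 0"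
    unfolding A1_def A2_def A3_def A4_def
    using B(1) by (intro sum_nonneg add_nonneg_nonneg mult_nonneg_nonneg divide_nonneg_pos K0 \<beta>
        norm_ge_zero; simp)+
  define \<eta> where "\<eta> = min (min \<tau> (\<rho> / 2)) (\<tau> * (b - a) / 4)"
  have \<eta>: "\<eta> > 0" "\<eta> \<le> \<tau>" "\<eta> \<le> \<rho> / 2" "\<eta> \<le> \<tau> * (b - a) / 4"
    using \<tau> \<rho> I by (auto simp: \<eta>_def)
  define N where "N = max 1 ((A1 + A2 + A3 + A4) / \<eta>)"
  have N: "N \<ge> 1" by (simp add: N_def)
  have "(A1 + A2 + A3 + A4) / \<eta> \<le> N" by (simp add: N_def)
  then have "(A1 + A2 + A3 + A4) / N \<le> \<eta>" using N \<eta>(1) by (simp add: field_simps)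
  moreover have "(A1 + A2 + A3 + A4) / N = A1 / N + A2 / N + A3 / N + A4 / N" by (simp add: add_divide_distrib)
  moreover have "A1 / N \<ge> 0" "A2 / N \<ge> 0" "A3 / N \<ge> 0" "A4 / N \<ge> 0" using A N by auto
  ultimately have AN: "A1 / N + A2 / N \<le> \<rho> / 2" "A1 / N \<le> \<rho> / 2" "A2 / N \<le> \<tau>" "A3 / N \<le> \<tau>" "A4 / N \<le> \<tau> * (b - a) / 4"
    using \<eta> by linarith+
  define U where "U = u N"
  define \<sigma> where "\<sigma> z = \<zeta> z * g (N * (l \<bullet> z))" for z
  have smU: "smooth U"
    unfolding U_def u_def
    by (intro smooth_mult \<zeta> smooth_compose_real[OF F(1)] smooth_const smooth_bounded_linear
        bounded_linear_inner_right)
  have U0: "U z = 0" if "z \<notin> C" for z using \<zeta>(6)[OF that] by (simp add: U_def u_def)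
  have closedC: "closed C" by (rule compact_imp_closed[OF \<zeta>(4)])
  have D0: "dir_deriv v U z = 0" if "z \<notin> C" for v z
    by (rule dir_deriv_eq_0[OF closedC U0 that])
  have smD: "smooth (dir_deriv v U)" for v by (rule smooth_dir_deriv[OF smU])
  have P1: "\<bar>dir_deriv e U z\<bar> \<le> A1 * N" "\<bar>dir_deriv f U z\<bar> \<le> K f T * N"
    "\<bar>dir_deriv T (dir_deriv e U) z - N\<^sup>2 * \<beta> * \<sigma> z\<bar> \<le> A1 * N"
    "\<bar>dir_deriv T (dir_deriv f U) z\<bar> \<le> K f T * N"
    "\<bar>dir_deriv (axis i 1, 0) (dir_deriv e U) z - N\<^sup>2 * q $ i * \<sigma> z\<bar> \<le> K e (axis i 1, 0) * N" for z i
    using K(2)[OF N, of e z T] K(2)[OF N, of f z T] K(3)[OF N, of T e z] K(3)[OF N, of T f z]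
      K(3)[OF N, of "(axis i 1, 0)" e z]
    by (simp_all add: l A1_def U_def \<sigma>_def)
  define \<phi> where "\<phi> z = 1 / N\<^sup>2 * dir_deriv e U z" for z
  define \<psi> where "\<psi> z = (1 / (\<beta> * N\<^sup>2)) *\<^sub>R (dir_deriv e U z *\<^sub>R \<gamma> - dir_deriv f U z *\<^sub>R q)" for z
  have sm\<phi>: "smooth \<phi>" unfolding \<phi>_def by (intro smooth_mult smooth_const smD)
  have sm\<psi>': "smooth (\<lambda>z. dir_deriv e U z *\<^sub>R \<gamma> - dir_deriv f U z *\<^sub>R q)"
    by (intro smooth_scaleR smooth_const smooth_diff smD)
  have sm\<psi>: "smooth \<psi>" unfolding \<psi>_def by (intro smooth_scaleR smooth_const sm\<psi>')
  have \<sigma>range: "s1 \<le> \<sigma> z" "\<sigma> z \<le> s2" for z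
  proof -
    have "\<zeta> z * g (N * (l \<bullet> z)) \<ge> \<zeta> z * s1" by (intro mult_left_mono g \<zeta>)
    moreover have "\<zeta> z * s1 \<ge> 1 * s1" by (rule mult_right_mono_neg) (use \<zeta> s in auto)
    ultimately show "s1 \<le> \<sigma> z" by (simp add: \<sigma>_def)
    have "\<zeta> z * g (N * (l \<bullet> z)) \<le> \<zeta> z * s2" by (intro mult_left_mono g \<zeta>)
    moreover have "\<zeta> z * s2 \<le> 1 * s2" by (rule mult_right_mono) (use \<zeta> s in auto)
    ultimately show "\<sigma> z \<le> s2" by (simp add: \<sigma>_def)
  qed
  have scale2: "norm ((1 / (\<beta> * N\<^sup>2)) *\<^sub>R (x *\<^sub>R \<gamma> - y *\<^sub>R q)) \<le> A2 / N"
    if "\<bar>x\<bar> \<le> A1 * N" "\<bar>y\<bar> \<le> K f T * N" for x y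
  proof -
    have "norm (x *\<^sub>R \<gamma> - y *\<^sub>R q) \<le> \<bar>x\<bar> * norm \<gamma> + \<bar>y\<bar>"
      using norm_triangle_ineq4[of "x *\<^sub>R \<gamma>" "y *\<^sub>R q"] q by simp
    also have "\<dots> \<le> (A1 * N) * norm \<gamma> + K f T * N"
      by (intro add_mono mult_right_mono that) auto
    also have "\<dots> = \<beta> * A2 * N"
    proof -
      have "\<beta> * A2 = K e T * norm \<gamma> + K f T" using \<beta> by (simp add: A2_def)
      then show ?thesis unfolding A1_def by (simp add: algebra_simps)
    qed
    finally have "(1 / (\<beta> * N\<^sup>2)) * norm (x *\<^sub>R \<gamma> - y *\<^sub>R q) \<le> (1 / (\<beta> * N\<^sup>2)) * (\<beta> * A2 * N)"
      using \<beta> by (intro mult_left_mono) auto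
    also have "\<dots> = A2 / N" using \<beta> N by (simp add: power2_eq_square)
    finally show ?thesis using \<beta> by simp
  qed
  have scale1: "\<bar>1 / N\<^sup>2 * x\<bar> \<le> k / N" if "\<bar>x\<bar> \<le> k * N" for x k
  proof -
    have "\<bar>1 / N\<^sup>2 * x\<bar> = 1 / N\<^sup>2 * \<bar>x\<bar>" by (simp add: abs_mult)
    also have "\<dots> \<le> 1 / N\<^sup>2 * (k * N)" by (intro mult_left_mono that) auto
    also have "\<dots> = k / N" using N by (simp add: power2_eq_square)
    finally show ?thesis .
  qed
  show ?thesis
  proof (rule that[of \<phi> \<psi> \<sigma>])
    show "smooth \<phi>" "smooth \<psi>" by (rule sm\<phi> sm\<psi>)+
    show "(\<lambda>z. (\<phi> z, \<psi> z)) \<in> Cc_infty (box c d \<times> box a b)"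
      by (rule Cc_inftyI[OF smooth_Pair[OF sm\<phi> sm\<psi>] \<zeta>(4)])
        (use \<zeta>(5) in \<open>auto simp: box_Pair_eq \<phi>_def \<psi>_def D0 zero_prod_def\<close>)
    show "div_x \<psi> z = 0" for z
      unfolding \<psi>_def e_def f_def by (rule div_x_antisymmetric[OF smU])
    show "(LINT x:box c d|lborel. \<phi> (x, t)) = 0" for t
    proof -
      have eq: "dir_deriv e U (x, t) = dir_deriv q (\<lambda>x. U (x, t)) x" for x
        using dir_deriv_eqI[OF has_derivative_slice_x[OF smU], of q t x] by (simp add: e_def)
      have out: "x \<notin> fst ` C \<Longrightarrow> (x, t) \<notin> C" for x by force
      have "(\<lambda>x. indicator (box c d) x *\<^sub>R \<phi> (x, t)) = (\<lambda>x. 1 / N\<^sup>2 * dir_deriv q (\<lambda>x. U (x, t)) x)"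
      proof (rule ext)
        fix x
        show "indicator (box c d) x *\<^sub>R \<phi> (x, t) = 1 / N\<^sup>2 * dir_deriv q (\<lambda>x. U (x, t)) x"
          using D0[of "(x, t)" e] \<zeta>(5) by (cases "x \<in> box c d") (auto simp: \<phi>_def eq[symmetric] box_Pair_eq)
      qed
      moreover have "integral\<^sup>L lborel (dir_deriv q (\<lambda>x. U (x, t))) = 0"
        by (rule integral_dir_deriv_eq_0[OF smooth_slice_x[OF smU], of "fst ` C"])
          (auto intro!: compact_continuous_image \<zeta>(4) continuous_intros U0 out)
      ultimately show ?thesis unfolding set_lebesgue_integral_def by simp
    qed
    show "norm (\<phi> z, \<psi> z) \<le> \<rho>" for z
    proof -
      have "norm (\<phi> z, \<psi> z) \<le> norm (\<phi> z) + norm (\<psi> z)" by (rule norm_Pair_le)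
      also have "\<dots> \<le> A1 / N + A2 / N"
        unfolding \<phi>_def \<psi>_def real_norm_def by (intro add_mono scale1 scale2 P1)
      finally show ?thesis using AN(1) \<rho> by linarith
    qed
    show "\<bar>deriv_t \<phi> z\<bar> \<le> \<rho>" for z
    proof -
      have "deriv_t \<phi> z = 1 / N\<^sup>2 * dir_deriv T (dir_deriv e U) z"
        unfolding deriv_t_eq_dir_deriv[OF sm\<phi>] T_def[symmetric] \<phi>_def
        by (rule dir_deriv_linear_image[OF bounded_linear_mult_right smD])
      also have "\<dots> = 1 / N\<^sup>2 * (dir_deriv T (dir_deriv e U) z - N\<^sup>2 * \<beta> * \<sigma> z) + \<beta> * \<sigma> z"
        using N by (simp add: algebra_simps)
      finally have "\<bar>deriv_t \<phi> z\<bar> \<le> \<bar>1 / N\<^sup>2 * (dir_deriv T (dir_deriv e U) z - N\<^sup>2 * \<beta> * \<sigma> z)\<bar> + \<bar>\<beta> * \<sigma> z\<bar>"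
        by (metis abs_triangle_ineq)
      also have "\<dots> \<le> A1 / N + \<beta> * L"
      proof (intro add_mono scale1 P1)
        have "\<bar>\<sigma> z\<bar> \<le> L" using \<sigma>range[of z] s unfolding L_def by linarith
        then show "\<bar>\<beta> * \<sigma> z\<bar> \<le> \<beta> * L" using \<beta> by (simp add: abs_mult)
      qed
      also have "\<beta> * L = \<rho> / 2" using L by (simp add: \<beta>_def)
      finally show ?thesis using AN(2) by linarith
    qed
    show "s1 \<le> \<sigma> z" "\<sigma> z \<le> s2" for z by (rule \<sigma>range)+
    show "norm (grad_x \<phi> z - \<sigma> z *\<^sub>R q) \<le> \<tau>" for z
    proof -
      have comp: "\<bar>(grad_x \<phi> z - \<sigma> z *\<^sub>R q) $ i\<bar> \<le> K e (axis i 1, 0) / N" for i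
      proof -
        have "grad_x \<phi> z $ i = 1 / N\<^sup>2 * dir_deriv (axis i 1, 0) (dir_deriv e U) z"
          unfolding grad_x_def vec_lambda_beta partial_x_eq_dir_deriv[OF sm\<phi>] \<phi>_def
          by (rule dir_deriv_linear_image[OF bounded_linear_mult_right smD])
        then have "(grad_x \<phi> z - \<sigma> z *\<^sub>R q) $ i
          = 1 / N\<^sup>2 * (dir_deriv (axis i 1, 0) (dir_deriv e U) z - N\<^sup>2 * q $ i * \<sigma> z)"
          using N by (simp add: algebra_simps)
        then show ?thesis using scale1[OF P1(5)] by simp
      qed
      have "norm (grad_x \<phi> z - \<sigma> z *\<^sub>R q) \<le> (\<Sum>i\<in>UNIV. \<bar>(grad_x \<phi> z - \<sigma> z *\<^sub>R q) $ i\<bar>)"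
        by (rule norm_le_l1_cart)
      also have "\<dots> \<le> (\<Sum>i\<in>UNIV. K e (axis i 1, 0) / N)" by (intro sum_mono comp)
      also have "\<dots> = A3 / N" by (simp add: A3_def sum_divide_distrib)
      finally show ?thesis using AN(4) by linarith
    qed
    show "norm (deriv_t \<psi> z - \<sigma> z *\<^sub>R \<gamma>) \<le> \<tau>" for z
    proof -
      have "dir_deriv T (\<lambda>z. dir_deriv e U z *\<^sub>R \<gamma> - dir_deriv f U z *\<^sub>R q) z
          = dir_deriv T (dir_deriv e U) z *\<^sub>R \<gamma> - dir_deriv T (dir_deriv f U) z *\<^sub>R q"
        by (subst dir_deriv_diff)
          (simp_all add: smooth_scaleR smD dir_deriv_linear_image[OF bounded_linear_scaleR_left smD])
      then have "deriv_t \<psi> z = (1 / (\<beta> * N\<^sup>2)) *\<^sub>R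
          (dir_deriv T (dir_deriv e U) z *\<^sub>R \<gamma> - dir_deriv T (dir_deriv f U) z *\<^sub>R q)"
        unfolding deriv_t_eq_dir_deriv[OF sm\<psi>] T_def[symmetric] \<psi>_def
        by (subst dir_deriv_linear_image[OF bounded_linear_scaleR_right sm\<psi>']) simp
      then have "deriv_t \<psi> z - \<sigma> z *\<^sub>R \<gamma> = (1 / (\<beta> * N\<^sup>2)) *\<^sub>R
          ((dir_deriv T (dir_deriv e U) z - N\<^sup>2 * \<beta> * \<sigma> z) *\<^sub>R \<gamma> - dir_deriv T (dir_deriv f U) z *\<^sub>R q)"
        using N \<beta> by (simp add: algebra_simps)
      then have "norm (deriv_t \<psi> z - \<sigma> z *\<^sub>R \<gamma>) \<le> A2 / N" using scale2[OF P1(3,4)] by simp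
      then show ?thesis using AN(3) by linarith
    qed
    have cont\<sigma>: "continuous_on UNIV \<sigma>"
      unfolding \<sigma>_def
      by (intro smooth_continuous_on smooth_mult \<zeta> smooth_compose_real[OF F(4)] smooth_const
          smooth_bounded_linear bounded_linear_inner_right)
    then have contK: "continuous_on UNIV (\<lambda>z. (s2 - \<sigma> z) * (\<sigma> z - s1))"
      by (intro continuous_intros)
    show intK: "set_integrable lborel (box c d \<times> box a b) (\<lambda>z. (s2 - \<sigma> z) * (\<sigma> z - s1))"
      unfolding box_Pair_eq[symmetric] by (rule set_integrable_box[OF contK])
    \<comment> \<open>The weight without the cutoff; the two agree on \<open>E\<close>, where \<open>\<zeta> = 1\<close>.\<close>
    define G where "G z = (s2 - g (N * (l \<bullet> z))) * (g (N * (l \<bullet> z)) - s1)" for z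
    have "smooth (\<lambda>z. g (N * (l \<bullet> z)))"
      by (intro smooth_compose_real[OF F(4)] smooth_mult smooth_const smooth_bounded_linear
          bounded_linear_inner_right)
    then have contG: "continuous_on UNIV G"
      unfolding G_def by (intro continuous_intros smooth_continuous_on)
    have G0: "0 \<le> G z" for z unfolding G_def using g by (intro mult_nonneg_nonneg) auto
    define M where "M = A4 / N + \<tau> / 2 * (b - a)"
    have M: "0 \<le> M" unfolding M_def using A(4) N \<tau> I by (intro add_nonneg_nonneg) auto
    have "(\<integral>\<^sup>+t. ennreal (G (x, t)) * indicator {a..b} t \<partial>lborel) \<le> ennreal M" for x
    proof -
      define H where "H t = J (N * (q \<bullet> x + \<beta> * t)) / (N * \<beta>) + m * t" for t
      have lx: "l \<bullet> (x, t) = q \<bullet> x + \<beta> * t" for t by (simp add: l_def)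
      have "(\<integral>\<^sup>+t. ennreal (G (x, t)) * indicator {a..b} t \<partial>lborel) = ennreal (H b - H a)"
      proof (rule nn_integral_FTC_Icc)
        show "(\<lambda>t. G (x, t)) \<in> borel_measurable borel"
          by (intro borel_measurable_continuous_onI continuous_on_compose2[OF contG] continuous_intros) auto
        show "(H has_real_derivative G (x, t)) (at t)" for t
        proof -
          have "((\<lambda>t. J (N * (q \<bullet> x + \<beta> * t))) has_real_derivative (G (x, t) - m) * (N * \<beta>)) (at t)"
            unfolding G_def lx by (rule DERIV_chain2[OF J]) (auto intro!: derivative_eq_intros)
          from DERIV_add[OF DERIV_cdivide[OF this, of "N * \<beta>"] DERIV_cmult_Id[of m]]
          show ?thesis using N \<beta> by (simp add: H_def[abs_def])
        qed
      qed (use G0 I in auto)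
      also have "H b - H a \<le> M"
      proof -
        have "J (N * (q \<bullet> x + \<beta> * b)) - J (N * (q \<bullet> x + \<beta> * a)) \<le> 2 * B"
          using B(4)[of "N * (q \<bullet> x + \<beta> * b)"] B(4)[of "N * (q \<bullet> x + \<beta> * a)"] by linarith
        then have "(J (N * (q \<bullet> x + \<beta> * b)) - J (N * (q \<bullet> x + \<beta> * a))) / (N * \<beta>) \<le> 2 * B / (N * \<beta>)"
          using N \<beta> by (intro divide_right_mono) auto
        moreover have "m * (b - a) \<le> \<tau> / 2 * (b - a)" using m I by (intro mult_right_mono) auto
        ultimately show ?thesis
          unfolding H_def M_def A4_def by (simp add: diff_divide_distrib algebra_simps)
      qed
      finally show ?thesis by (simp add: ennreal_leI)
    qed
    from integral_box_product_le[OF contG G0 M this, of c d]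
    have intG: "(LINT z:\<Omega>|lborel. G z) \<le> measure lborel (box c d) * M" by (simp add: \<Omega>_def)
    have sG: "set_integrable lborel \<Omega> G" unfolding \<Omega> by (rule set_integrable_box[OF contG])
    have meas: "\<Omega> - E \<in> sets lborel" unfolding \<Omega> using E(1) by auto
    have "emeasure lborel (\<Omega> - E) \<le> emeasure lborel \<Omega>"
      by (rule emeasure_mono) (auto simp: \<Omega>)
    also have "\<dots> < \<infinity>" unfolding \<Omega> by (rule emeasure_lborel_box_finite)
    finally have fin: "emeasure lborel (\<Omega> - E) < \<infinity>" .
    have ind: "(\<lambda>z. indicator \<Omega> z *\<^sub>R (L\<^sup>2 * indicator (\<Omega> - E) z)) = (\<lambda>z. L\<^sup>2 * indicator (\<Omega> - E) z :: real)"
      by (auto simp: indicator_def fun_eq_iff)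
    have sE: "set_integrable lborel \<Omega> (\<lambda>z. L\<^sup>2 * indicator (\<Omega> - E) z)"
      unfolding set_integrable_def ind
      by (intro integrable_mult_right integrable_real_indicator meas fin)
    have "(LINT z:\<Omega>|lborel. (s2 - \<sigma> z) * (\<sigma> z - s1)) \<le> (LINT z:\<Omega>|lborel. G z + L\<^sup>2 * indicator (\<Omega> - E) z)"
    proof (rule set_integral_mono)
      show "set_integrable lborel \<Omega> (\<lambda>z. (s2 - \<sigma> z) * (\<sigma> z - s1))" using intK by (simp add: \<Omega>_def)
      show "set_integrable lborel \<Omega> (\<lambda>z. G z + L\<^sup>2 * indicator (\<Omega> - E) z)"
        by (rule set_integral_add(1)[OF sG sE])
      fix z assume z: "z \<in> \<Omega>"
      show "(s2 - \<sigma> z) * (\<sigma> z - s1) \<le> G z + L\<^sup>2 * indicator (\<Omega> - E) z"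
      proof (cases "z \<in> E")
        case True
        then show ?thesis by (simp add: G_def \<sigma>_def E(2))
      next
        case False
        have "(s2 - \<sigma> z) * (\<sigma> z - s1) \<le> L * L"
          using \<sigma>range[of z] s by (intro mult_mono) (auto simp: L_def)
        then show ?thesis using False z G0[of z] by (simp add: power2_eq_square)
      qed
    qed
    also have "\<dots> = (LINT z:\<Omega>|lborel. G z) + (LINT z:\<Omega>|lborel. L\<^sup>2 * indicator (\<Omega> - E) z)"
      by (rule set_integral_add(2)[OF sG sE])
    also have "(LINT z:\<Omega>|lborel. L\<^sup>2 * indicator (\<Omega> - E) z) = L\<^sup>2 * measure lborel (\<Omega> - E)"
      unfolding set_lebesgue_integral_def ind using meas fin by simp
    also have "(LINT z:\<Omega>|lborel. G z) + L\<^sup>2 * measure lborel (\<Omega> - E) \<le> \<tau> * measure lborel \<Omega>"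
    proof -
      have "L\<^sup>2 * measure lborel (\<Omega> - E) \<le> L\<^sup>2 * (\<tau> * measure lborel \<Omega> / (4 * L\<^sup>2))"
        using E(3) by (intro mult_left_mono) (auto simp: \<Omega>)
      also have "\<dots> = \<tau> * measure lborel \<Omega> / 4" using L by simp
      finally have 1: "L\<^sup>2 * measure lborel (\<Omega> - E) \<le> \<tau> * measure lborel \<Omega> / 4" .
      have "\<tau> / 2 * (b - a) = 2 * (\<tau> * (b - a) / 4)" by simp
      then have "M \<le> 3 * (\<tau> * (b - a) / 4)" unfolding M_def using AN(5) by linarith
      then have "measure lborel (box c d) * M \<le> measure lborel (box c d) * (3 * (\<tau> * (b - a) / 4))"
        by (intro mult_left_mono) auto
      also have "\<dots> = 3 / 4 * \<tau> * measure lborel \<Omega>" by (simp add: m\<Omega>)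
      finally show ?thesis using 1 intG by linarith
    qed
    finally show "(LINT z:(box c d \<times> box a b)|lborel. (s2 - \<sigma> z) * (\<sigma> z - s1))
      \<le> \<tau> * measure lborel (box c d \<times> box a b)" by (simp add: \<Omega>_def)
  qed
qed

section \<open>The sets \<open>S\<^sub>\<delta>\<close> and their line segments\<close>

text \<open>A polynomial measure of how far \<open>(p,\<beta>)\<close> is from the graph of the flux. With \<open>e = \<beta> - \<sigma>(p)\<close> it
  equals \<open>- (e + (p \<bullet> e) p)\<close>, so that it vanishes exactly on the graph.\<close>

definition defect :: "real ^ 'n \<Rightarrow> real ^ 'n \<Rightarrow> real ^ 'n" where
  "defect p \<beta> = (1 - p \<bullet> \<beta>) *\<^sub>R p - \<beta>"

lemma S_set_iff: "(p, \<beta>) \<in> S_set \<delta> \<longleftrightarrow> \<delta> * norm (defect p \<beta>) < defect p \<beta> \<bullet> \<beta>"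
proof -
  have "defect p \<beta> \<bullet> \<beta> = p \<bullet> \<beta> - (p \<bullet> \<beta>)\<^sup>2 - (norm \<beta>)\<^sup>2"
    unfolding defect_def power2_norm_eq_inner
    by (simp add: inner_diff_left power2_eq_square algebra_simps)
  then show ?thesis by (auto simp: S_set_def defect_def)
qed

lemma norm_flux_diff_le_defect: "norm (\<beta> - flux p) \<le> norm (defect p \<beta>)"
proof (cases "\<beta> = flux p")
  case False
  define e where "e = \<beta> - flux p"
  have e: "norm e > 0" using False by (simp add: e_def)
  have pos: "1 + p \<bullet> p > 0" using inner_ge_zero[of p] by linarith
  have fp: "p \<bullet> flux p = p \<bullet> p / (1 + p \<bullet> p)" by (simp add: flux_def power2_norm_eq_inner)
  have "1 - p \<bullet> flux p = 1 / (1 + p \<bullet> p)" unfolding fp using pos by (simp add: field_simps)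
  then have z: "(1 - p \<bullet> flux p) *\<^sub>R p = flux p" by (simp add: flux_def power2_norm_eq_inner)
  have "defect p \<beta> = (1 - p \<bullet> flux p) *\<^sub>R p - (p \<bullet> e) *\<^sub>R p - \<beta>"
    by (simp add: defect_def e_def inner_diff_right algebra_simps)
  then have d: "defect p \<beta> = - (e + (p \<bullet> e) *\<^sub>R p)"
    unfolding z by (simp add: e_def)
  have "norm e * norm e \<le> e \<bullet> e + (p \<bullet> e)\<^sup>2" by (simp add: dot_square_norm power2_eq_square)
  also have "\<dots> = - (e \<bullet> defect p \<beta>)"
    by (simp add: d inner_add_right inner_diff_right power2_eq_square inner_commute)
  also have "\<dots> \<le> norm e * norm (defect p \<beta>)"
    using Cauchy_Schwarz_ineq2[of e "defect p \<beta>"] by linarith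
  finally show ?thesis using e by (simp add: e_def)
qed simp

text \<open>With \<open>P = p \<bullet> \<beta>\<close> membership gives \<open>\<delta>\<^sup>2 < |\<beta>|\<^sup>2 < (1 - P) P\<close>. So \<open>1 - P\<close> is bounded below, and
  \<open>p = (w + \<beta>) / (1 - P)\<close> is bounded.\<close>

lemma S_set_bounded:
  fixes \<delta> :: real
  assumes "\<delta> > 0"
  shows "bounded (S_set \<delta> :: ((real ^ 'n) \<times> (real ^ 'n)) set)"
  unfolding bounded_iff
proof (intro exI ballI)
  fix z :: "(real ^ 'n) \<times> (real ^ 'n)"
  assume "z \<in> S_set \<delta>"
  then obtain p \<beta> where z: "z = (p, \<beta>)" and S: "(p, \<beta>) \<in> S_set \<delta>" by (cases z) auto
  define w where "w = defect p \<beta>"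
  define P where "P = p \<bullet> \<beta>"
  have wb: "w \<bullet> \<beta> = (1 - P) * P - (norm \<beta>)\<^sup>2"
    by (simp add: w_def defect_def P_def inner_diff_left power2_norm_eq_inner)
  have S: "\<delta> * norm w < w \<bullet> \<beta>" using S by (simp add: S_set_iff w_def)
  have "0 < w \<bullet> \<beta>" using S assms mult_nonneg_nonneg[of \<delta> "norm w"] norm_ge_zero[of w] by linarith
  then have w: "norm w > 0" and b2: "(norm \<beta>)\<^sup>2 < (1 - P) * P" using wb by auto
  have "w \<bullet> \<beta> \<le> norm w * norm \<beta>" by (rule norm_cauchy_schwarz)
  then have "norm w * \<delta> < norm w * norm \<beta>" using S by (simp add: mult.commute)
  then have b: "\<delta> < norm \<beta>" using w by simp
  then have "\<delta>\<^sup>2 < (norm \<beta>)\<^sup>2" using assms by (intro power_strict_mono) auto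
  with b2 have PP: "\<delta>\<^sup>2 < (1 - P) * P" by linarith
  then have PP0: "0 < (1 - P) * P" using zero_le_power2[of \<delta>] by linarith
  have "0 < P"
  proof (rule ccontr)
    assume "\<not> 0 < P"
    then have "(1 - P) * P \<le> 0" by (intro mult_nonneg_nonpos) auto
    then show False using PP0 by linarith
  qed
  moreover have "P < 1" using PP0 calculation by (simp add: zero_less_mult_iff)
  ultimately have P: "0 < P" "P < 1" by auto
  have x: "\<delta>\<^sup>2 \<le> 1 - P"
  proof -
    have "(1 - P) * P \<le> (1 - P) * 1" using P by (intro mult_left_mono) auto
    then have "(1 - P) * P \<le> 1 - P" by (simp only: mult_1_right)
    with PP show ?thesis by (rule order_trans[OF less_imp_le])
  qed
  have "(1 - P) * P \<le> 1 * 1" using P by (intro mult_mono) auto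
  then have "(norm \<beta>)\<^sup>2 \<le> 1\<^sup>2" using b2 by simp
  then have b1: "norm \<beta> \<le> 1" by (rule power2_le_imp_le) simp
  have "\<delta> * norm w \<le> 1" using S wb \<open>(1 - P) * P \<le> 1 * 1\<close> zero_le_power2[of "norm \<beta>"] by linarith
  then have w1: "norm w \<le> 1 / \<delta>" using assms by (simp add: field_simps)
  have "(1 - P) *\<^sub>R p = w + \<beta>" by (simp add: w_def defect_def P_def)
  then have "(1 - P) * norm p = norm (w + \<beta>)" using P by (metis abs_of_pos diff_gt_0_iff_gt norm_scaleR)
  also have "\<dots> \<le> 1 / \<delta> + 1" using norm_triangle_ineq[of w \<beta>] w1 b1 by linarith
  finally have "(1 - P) * norm p \<le> 1 / \<delta> + 1" .
  moreover have "\<delta>\<^sup>2 * norm p \<le> (1 - P) * norm p" using x by (rule mult_right_mono) simp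
  ultimately have "\<delta>\<^sup>2 * norm p \<le> 1 / \<delta> + 1" by linarith
  then have "norm p \<le> (1 / \<delta> + 1) / \<delta>\<^sup>2" using assms by (simp add: pos_le_divide_eq mult.commute)
  then show "norm z \<le> (1 / \<delta> + 1) / \<delta>\<^sup>2 + 1"
    unfolding z using norm_Pair_le[of p \<beta>] b1 by linarith
qed

lemma open_S_set: "open (S_set \<delta>)"
  unfolding S_set_def case_prod_unfold by (intro open_Collect_less continuous_intros)

lemma continuous_defect: "continuous_on S (\<lambda>z. defect (fst z) (snd z))"
  unfolding defect_def by (intro continuous_intros)

lemma compact_defect_set:
  fixes \<delta> \<delta>' \<kappa> :: real
  assumes "0 < \<delta>" "\<delta> < \<delta>'" "0 < \<kappa>"
  defines "C \<equiv> {z :: (real ^ 'n) \<times> (real ^ 'n). \<kappa> \<le> norm (defect (fst z) (snd z)) \<and>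
    \<delta>' * norm (defect (fst z) (snd z)) \<le> defect (fst z) (snd z) \<bullet> snd z}"
  shows "compact C" "C \<subseteq> S_set \<delta>"
proof -
  show sub: "C \<subseteq> S_set \<delta>"
  proof
    fix z assume z: "z \<in> C"
    have "\<delta> * norm (defect (fst z) (snd z)) < \<delta>' * norm (defect (fst z) (snd z))"
      using z assms by (intro mult_strict_right_mono) (auto simp: C_def)
    then have "(fst z, snd z) \<in> S_set \<delta>" unfolding S_set_iff using z by (auto simp: C_def)
    then show "z \<in> S_set \<delta>" by simp
  qed
  have "closed C"
    unfolding C_def
    by (intro closed_Collect_conj closed_Collect_le continuous_intros continuous_defect)
  moreover have "bounded C" by (rule bounded_subset[OF S_set_bounded[OF assms(1)] sub])
  ultimately show "compact C" by (simp add: compact_eq_bounded_closed)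
qed

text \<open>The rank-one segment through a point of \<open>S\<^sub>\<delta>\<close>. The vector \<open>\<gamma>\<close> is a multiple of the part \<open>r\<close> of \<open>p\<close>
  orthogonal to \<open>q\<close>; the factor \<open>- k\<close> is the one for which the linear term of the defect has no component
  orthogonal to \<open>q\<close>. Positivity of \<open>k\<close>, that is of \<open>q \<bullet> \<beta>\<close>, makes the quadratic concave, so that the
  value \<open>\<kappa>\<close> is attained on both sides of \<open>s = 0\<close>.\<close>

lemma S_set_segment:
  fixes p \<beta> :: "real ^ 'n"
  assumes "0 < \<delta>" "(p, \<beta>) \<in> S_set \<delta>" "0 < \<kappa>" "\<kappa> < norm (defect p \<beta>)"
  obtains q \<gamma> s1 s2 k where "norm q = 1" "q \<bullet> \<gamma> = 0" "s1 < 0" "0 < s2" "0 < k"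
    "defect p \<beta> = norm (defect p \<beta>) *\<^sub>R q"
    "\<And>s. defect (p + s *\<^sub>R q) (\<beta> + s *\<^sub>R \<gamma>) = (\<kappa> + k * ((s2 - s) * (s - s1))) *\<^sub>R q"
proof -
  define w where "w = defect p \<beta>"
  have w: "norm w > 0" "\<kappa> < norm w" using assms by (auto simp: w_def)
  define q where "q = (1 / norm w) *\<^sub>R w"
  have q: "norm q = 1" "w = norm w *\<^sub>R q" using w(1) by (auto simp: q_def)
  have qq: "q \<bullet> q = 1" using q(1) by (simp add: dot_square_norm)
  have "\<delta> * norm w < w \<bullet> \<beta>" using assms(2) by (simp add: S_set_iff w_def)
  moreover have "0 < \<delta> * norm w" using assms(1) w by simp
  ultimately have "0 < w \<bullet> \<beta>" by linarith
  then have qb: "q \<bullet> \<beta> > 0" using w(1) by (simp add: q_def)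
  define r where "r = p - (p \<bullet> q) *\<^sub>R q"
  have rq: "q \<bullet> r = 0" by (simp add: r_def inner_diff_right qq inner_commute)
  have pr: "p \<bullet> r = r \<bullet> r"
  proof -
    have "r \<bullet> r = p \<bullet> r - (p \<bullet> q) * (q \<bullet> r)" by (subst r_def) (simp add: inner_diff_left)
    then show ?thesis by (simp add: rq)
  qed
  have r1: "1 + r \<bullet> r > 0" using inner_ge_zero[of r] by linarith
  define k where "k = (q \<bullet> \<beta>) / (1 + r \<bullet> r)"
  have k: "k > 0" "q \<bullet> \<beta> = k * (1 + r \<bullet> r)" using qb r1 by (auto simp: k_def)
  define \<gamma> where "\<gamma> = - k *\<^sub>R r"
  define A where "A = 1 - p \<bullet> \<beta> - k * (p \<bullet> q)"
  have quad: "defect (p + s *\<^sub>R q) (\<beta> + s *\<^sub>R \<gamma>) = (norm w + A * s - k * s\<^sup>2) *\<^sub>R q" for s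
  proof -
    have "(p + s *\<^sub>R q) \<bullet> (\<beta> + s *\<^sub>R \<gamma>) = p \<bullet> \<beta> + s * (q \<bullet> \<beta> - k * (p \<bullet> r)) - s * s * k * (q \<bullet> r)"
      by (simp add: \<gamma>_def inner_add_left inner_add_right algebra_simps)
    also have "\<dots> = p \<bullet> \<beta> + s * k" by (simp add: rq pr k(2) algebra_simps)
    finally have "defect (p + s *\<^sub>R q) (\<beta> + s *\<^sub>R \<gamma>)
        = (1 - (p \<bullet> \<beta> + s * k)) *\<^sub>R (p + s *\<^sub>R q) - (\<beta> + s *\<^sub>R \<gamma>)" by (simp add: defect_def)
    also have "\<dots> = w + (s * (1 - p \<bullet> \<beta> - s * k)) *\<^sub>R q - (s * k) *\<^sub>R (p - r)"
      by (simp add: w_def defect_def \<gamma>_def algebra_simps)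
    also have "p - r = (p \<bullet> q) *\<^sub>R q" by (simp add: r_def)
    also have "w + (s * (1 - p \<bullet> \<beta> - s * k)) *\<^sub>R q - (s * k) *\<^sub>R (p \<bullet> q) *\<^sub>R q
        = (norm w + s * (1 - p \<bullet> \<beta> - s * k) - s * k * (p \<bullet> q)) *\<^sub>R q"
      by (subst q(2)) (simp add: scaleR_add_left scaleR_diff_left)
    also have "norm w + s * (1 - p \<bullet> \<beta> - s * k) - s * k * (p \<bullet> q) = norm w + A * s - k * s\<^sup>2"
      by (simp add: A_def power2_eq_square algebra_simps)
    finally show ?thesis .
  qed
  define D where "D = sqrt (A\<^sup>2 + 4 * k * (norm w - \<kappa>))"
  have rad: "4 * k * (norm w - \<kappa>) > 0" using k w by simp
  then have D2: "D\<^sup>2 = A\<^sup>2 + 4 * k * (norm w - \<kappa>)" by (simp add: D_def)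
  have "\<bar>A\<bar> < D" unfolding D_def by (rule real_less_rsqrt) (use rad in simp)
  define s1 where "s1 = (A - D) / (2 * k)"
  define s2 where "s2 = (A + D) / (2 * k)"
  have s: "s1 < 0" "0 < s2" using \<open>\<bar>A\<bar> < D\<close> k by (auto simp: s1_def s2_def divide_less_0_iff)
  have sum: "k * (s1 + s2) = A" using k by (simp add: s1_def s2_def field_simps)
  have "k * (s1 * s2) = (A\<^sup>2 - D\<^sup>2) / (4 * k)"
    using k by (simp add: s1_def s2_def field_simps power2_eq_square)
  also have "\<dots> = - (norm w - \<kappa>)" unfolding D2 using k by (simp add: field_simps)
  finally have prd: "k * (s1 * s2) = - (norm w - \<kappa>)" .
  have fac: "norm w + A * s - k * s\<^sup>2 = \<kappa> + k * ((s2 - s) * (s - s1))" for s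
  proof -
    have "k * ((s2 - s) * (s - s1)) = (k * (s1 + s2)) * s - k * s\<^sup>2 - k * (s1 * s2)"
      by (simp add: power2_eq_square algebra_simps)
    then show ?thesis by (simp add: sum prd)
  qed
  show ?thesis
  proof (rule that[of q \<gamma> s1 s2 k])
    show "q \<bullet> \<gamma> = 0" by (simp add: \<gamma>_def rq)
    show "defect p \<beta> = norm (defect p \<beta>) *\<^sub>R q" using q(2) by (simp add: w_def)
    show "defect (p + s *\<^sub>R q) (\<beta> + s *\<^sub>R \<gamma>) = (\<kappa> + k * ((s2 - s) * (s - s1))) *\<^sub>R q" for s
      using quad fac by simp
  qed (use q s k in auto)
qed

lemma flux_lipschitz: "norm (flux x - flux y) \<le> norm (x - y)"
proof -
  define a where "a = 1 + (norm x)\<^sup>2"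
  define b where "b = 1 + (norm y)\<^sup>2"
  have ab: "a > 0" "b > 0" by (auto simp: a_def b_def add_pos_nonneg)
  have eq: "flux x - flux y = (1 / (a * b)) *\<^sub>R ((x - y) + ((norm y)\<^sup>2 *\<^sub>R x - (norm x)\<^sup>2 *\<^sub>R y))"
  proof -
    have "(1 / (a * b)) *\<^sub>R ((x - y) + ((norm y)\<^sup>2 *\<^sub>R x - (norm x)\<^sup>2 *\<^sub>R y)) = (1 / (a * b)) *\<^sub>R (b *\<^sub>R x - a *\<^sub>R y)"
      by (simp add: a_def b_def algebra_simps)
    also have "\<dots> = flux x - flux y"
      using ab by (simp add: flux_def a_def[symmetric] b_def[symmetric] scaleR_diff_right)
    finally show ?thesis by simp
  qed
  have sq: "norm ((norm y)\<^sup>2 *\<^sub>R x - (norm x)\<^sup>2 *\<^sub>R y) = norm x * norm y * norm (x - y)"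
  proof (rule power2_eq_imp_eq)
    show "(norm ((norm y)\<^sup>2 *\<^sub>R x - (norm x)\<^sup>2 *\<^sub>R y))\<^sup>2 = (norm x * norm y * norm (x - y))\<^sup>2"
      unfolding power_mult_distrib power2_norm_eq_inner
      by (simp add: inner_diff_left inner_diff_right inner_commute algebra_simps power2_eq_square)
  qed auto
  have "norm ((x - y) + ((norm y)\<^sup>2 *\<^sub>R x - (norm x)\<^sup>2 *\<^sub>R y)) \<le> (1 + norm x * norm y) * norm (x - y)"
    using norm_triangle_ineq[of "x - y" "(norm y)\<^sup>2 *\<^sub>R x - (norm x)\<^sup>2 *\<^sub>R y"] unfolding sq
    by (simp add: algebra_simps)
  also have "1 + norm x * norm y \<le> a * b"
  proof -
    have "2 * (norm x * norm y) \<le> (norm x)\<^sup>2 + (norm y)\<^sup>2"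
      using sum_squares_bound[of "norm x" "norm y"] by simp
    moreover have "0 \<le> norm x * norm y" "0 \<le> (norm x)\<^sup>2 * (norm y)\<^sup>2" by simp_all
    moreover have "a * b = 1 + (norm x)\<^sup>2 + (norm y)\<^sup>2 + (norm x)\<^sup>2 * (norm y)\<^sup>2"
      by (simp add: a_def b_def algebra_simps)
    ultimately show ?thesis by linarith
  qed
  finally have "norm ((x - y) + ((norm y)\<^sup>2 *\<^sub>R x - (norm x)\<^sup>2 *\<^sub>R y)) \<le> a * b * norm (x - y)"
    by (simp add: mult_right_mono)
  then show ?thesis unfolding eq using ab by (simp add: pos_divide_le_eq mult.commute)
qed

section \<open>Approximation by oscillating perturbations\<close>

lemma Linf_norm_less:
  fixes f :: "'a::euclidean_space \<Rightarrow> 'b::real_normed_vector"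
  assumes "continuous_on UNIV f" "\<And>z. norm (f z) \<le> c" "c < \<rho>"
  shows "Linf_norm E f < ereal \<rho>"
proof -
  have "(\<lambda>z. ereal (norm (f z))) \<in> borel_measurable borel"
    by (intro borel_measurable_ereal borel_measurable_continuous_onI continuous_on_norm assms(1))
  then have "(\<lambda>z. ereal (norm (f z))) \<in> borel_measurable (restrict_space lborel E)"
    by (intro measurable_restrict_space1) simp
  then have "Linf_norm E f \<le> ereal c"
    unfolding Linf_norm_def using assms(2) by (intro esssup_I) auto
  then show ?thesis using assms(3) by (simp add: le_less_trans)
qed

text \<open>Uniformly in \<open>(p,\<beta>) \<in> \<K>\<close>, the \<open>r\<close>-neighbourhood of the part of the segment where the defect is at
  least \<open>\<kappa>\<close> lies in \<open>S\<^sub>\<delta>\<close>. This part lies in the compact set of \<open>compact_defect_set\<close>, with \<open>\<delta>'\<close> the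
  minimum over \<open>\<K>\<close> of the ratio \<open>(w \<bullet> \<beta>) / |w| = q \<bullet> \<beta>\<close>, which does not change along the segment.\<close>

lemma S_set_perturbation:
  fixes \<delta> \<kappa>\<^sub>0 :: real and \<K> :: "((real ^ 'n) \<times> (real ^ 'n)) set"
  assumes \<delta>: "0 < \<delta>" and \<K>: "compact \<K>" "\<K> \<subseteq> S_set \<delta>" and \<kappa>\<^sub>0: "0 < \<kappa>\<^sub>0"
  obtains \<kappa> r where "0 < \<kappa>" "\<kappa> \<le> \<kappa>\<^sub>0" "0 < r"
    "\<And>p \<beta>. (p, \<beta>) \<in> \<K> \<Longrightarrow> \<kappa> < norm (defect p \<beta>)"
    "\<And>p \<beta> q \<gamma> h s x. (p, \<beta>) \<in> \<K> \<Longrightarrow> norm q = 1 \<Longrightarrow> q \<bullet> \<gamma> = 0 \<Longrightarrow>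
       defect p \<beta> = norm (defect p \<beta>) *\<^sub>R q \<Longrightarrow> \<kappa> \<le> h \<Longrightarrow>
       defect (p + s *\<^sub>R q) (\<beta> + s *\<^sub>R \<gamma>) = h *\<^sub>R q \<Longrightarrow>
       dist x (p + s *\<^sub>R q, \<beta> + s *\<^sub>R \<gamma>) < r \<Longrightarrow> x \<in> S_set \<delta>"
proof (cases "\<K> = {}")
  case True
  show ?thesis by (rule that[of \<kappa>\<^sub>0 1]) (use True \<kappa>\<^sub>0 in auto)
next
  case False
  let ?w = "\<lambda>z :: (real ^ 'n) \<times> (real ^ 'n). defect (fst z) (snd z)"
  have S: "\<delta> * norm (?w z) < ?w z \<bullet> snd z" if "z \<in> \<K>" for z
  proof -
    have "(fst z, snd z) \<in> S_set \<delta>" using \<K>(2) that by auto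
    then show ?thesis by (simp only: S_set_iff)
  qed
  have w0: "?w z \<noteq> 0" if "z \<in> \<K>" for z using S[OF that] by auto
  have "continuous_on \<K> (\<lambda>z. norm (?w z))" by (intro continuous_intros continuous_defect)
  from continuous_attains_inf[OF \<K>(1) False this]
  obtain z1 where z1: "z1 \<in> \<K>" "\<And>z. z \<in> \<K> \<Longrightarrow> norm (?w z1) \<le> norm (?w z)" by blast
  have "continuous_on \<K> (\<lambda>z. (?w z \<bullet> snd z) / norm (?w z))"
    by (intro continuous_intros continuous_defect) (use w0 in auto)
  from continuous_attains_inf[OF \<K>(1) False this]
  obtain z2 where z2: "z2 \<in> \<K>"
    "\<And>z. z \<in> \<K> \<Longrightarrow> (?w z2 \<bullet> snd z2) / norm (?w z2) \<le> (?w z \<bullet> snd z) / norm (?w z)" by blast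
  define \<delta>' where "\<delta>' = (?w z2 \<bullet> snd z2) / norm (?w z2)"
  define \<kappa> where "\<kappa> = min \<kappa>\<^sub>0 (norm (?w z1) / 2)"
  have \<delta>': "\<delta> < \<delta>'" unfolding \<delta>'_def using S[OF z2(1)] w0[OF z2(1)] by (simp add: pos_less_divide_eq)
  have n1: "norm (?w z1) > 0" using w0[OF z1(1)] by simp
  then have \<kappa>: "0 < \<kappa>" "\<kappa> \<le> \<kappa>\<^sub>0" "\<kappa> < norm (?w z1)" unfolding \<kappa>_def using \<kappa>\<^sub>0 by linarith+
  define C where "C = {z :: (real ^ 'n) \<times> (real ^ 'n). \<kappa> \<le> norm (?w z) \<and> \<delta>' * norm (?w z) \<le> ?w z \<bullet> snd z}"
  have C: "compact C" "C \<subseteq> S_set \<delta>"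
    unfolding C_def using compact_defect_set[OF \<delta> \<delta>' \<kappa>(1)] by auto
  obtain r where r: "r > 0" "(\<Union>z\<in>C. ball z r) \<subseteq> S_set \<delta>"
    by (rule compact_subset_open_imp_ball_epsilon_subset[OF C(1) open_S_set C(2)])
  show ?thesis
  proof (rule that[OF \<kappa>(1,2) r(1)])
    show "\<kappa> < norm (defect p \<beta>)" if "(p, \<beta>) \<in> \<K>" for p \<beta>
      using z1(2)[OF that] \<kappa>(3) by simp
    fix p \<beta> q \<gamma> :: "real ^ 'n" and h s x
    assume a: "(p, \<beta>) \<in> \<K>" "norm q = 1" "q \<bullet> \<gamma> = 0" "defect p \<beta> = norm (defect p \<beta>) *\<^sub>R q"
      "\<kappa> \<le> h" and h: "defect (p + s *\<^sub>R q) (\<beta> + s *\<^sub>R \<gamma>) = h *\<^sub>R q"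
      and x: "dist x (p + s *\<^sub>R q, \<beta> + s *\<^sub>R \<gamma>) < r"
    have n: "norm (defect p \<beta>) > 0" using w0[OF a(1)] by simp
    have "\<delta>' \<le> (defect p \<beta> \<bullet> \<beta>) / norm (defect p \<beta>)" unfolding \<delta>'_def using z2(2)[OF a(1)] by simp
    also have "defect p \<beta> \<bullet> \<beta> = norm (defect p \<beta>) * (q \<bullet> \<beta>)" by (subst a(4)) simp
    finally have qb: "\<delta>' \<le> q \<bullet> \<beta>" using n by simp
    have h0: "h > 0" using a(5) \<kappa>(1) by linarith
    have "(p + s *\<^sub>R q, \<beta> + s *\<^sub>R \<gamma>) \<in> C"
      unfolding C_def using a h0 qb by (simp add: h inner_add_right mult.commute)
    then have "x \<in> (\<Union>z\<in>C. ball z r)" using x by (intro UN_I) (auto simp: dist_commute)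
    then show "x \<in> S_set \<delta>" using r(2) by blast
  qed
qed

theorem theorem4p6:
  fixes \<delta> \<epsilon> :: real
    and \<K> :: "((real ^ 'n) \<times> (real ^ 'n)) set"
    and Q' :: "(real ^ 'n) set" and I' :: "real set"
  assumes "0 < \<delta>" and "\<delta> < 1/2"
    and "compact \<K>" and "\<K> \<subseteq> S_set \<delta>"
    and "open_box Q'" and "open_box I'"
    and "\<epsilon> > 0"
  shows "\<exists>\<rho>\<^sub>0>0. \<forall>Q I. open_box Q \<longrightarrow> open_box I \<longrightarrow> Q \<times> I \<subseteq> Q' \<times> I' \<longrightarrow>
    (\<forall>(p, \<beta>)\<in>\<K>. \<exists>\<rho>\<^sub>1>0. \<forall>\<rho>. 0 < \<rho> \<and> \<rho> < \<rho>\<^sub>1 \<longrightarrow>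
      (\<exists>(\<phi> :: (real ^ 'n) \<times> real \<Rightarrow> real) (\<psi> :: (real ^ 'n) \<times> real \<Rightarrow> real ^ 'n).
        (\<lambda>z. (\<phi> z, \<psi> z)) \<in> Cc_infty (Q \<times> I) \<and>
        (\<forall>z\<in>Q \<times> I. div_x \<psi> z = 0) \<and>
        (\<forall>z\<in>Q \<times> I. \<forall>p' \<beta>'. norm ((p', \<beta>') - (p, \<beta>)) \<le> \<rho>\<^sub>0 \<longrightarrow>
           (p' + grad_x \<phi> z, \<beta>' + deriv_t \<psi> z) \<in> S_set \<delta>) \<and>
        Linf_norm (Q \<times> I) (\<lambda>z. (\<phi> z, \<psi> z)) < ereal \<rho> \<and>
        (LINT z:(Q \<times> I)|lborel. norm (\<beta> + deriv_t \<psi> z - flux (p + grad_x \<phi> z)))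
          < \<epsilon> * measure lborel (Q \<times> I) / measure lborel (Q' \<times> I') \<and>
        (\<forall>t\<in>I. (LINT x:Q|lborel. \<phi> (x, t)) = 0) \<and>
        Linf_norm (Q \<times> I) (deriv_t \<phi>) < ereal \<rho>))"
proof -
  define V where "V = measure lborel (Q' \<times> I')"
  have box_pos: "measure lborel (Q \<times> I) > 0" if boxes: "open_box Q" "open_box I"
    for Q :: "(real ^ 'n) set" and I :: "real set"
  proof -
    obtain c d where "Q = box c d" "Q \<noteq> {}" using boxes(1) unfolding open_box_def by blast
    moreover obtain a b where "I = box a b" "I \<noteq> {}" using boxes(2) unfolding open_box_def by blast
    ultimately have "Q = box c d" "I = box a b" "box c d \<noteq> {}" "box a b \<noteq> {}" by auto
    then show ?thesis
      by (auto simp: measure_lborel_Times_box measure_lborel_box_eq box_ne_empty inner_diff_left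
          simp del: box_real intro!: mult_pos_pos prod_pos)
  qed
  have V: "V > 0" unfolding V_def by (rule box_pos) (rule assms)+
  define \<eta> where "\<eta> = \<epsilon> / V"
  have \<eta>: "\<eta> > 0" using V assms by (simp add: \<eta>_def)
  then have \<eta>4: "0 < \<eta> / 4" by simp
  obtain \<kappa> r where \<kappa>: "0 < \<kappa>" "\<kappa> \<le> \<eta> / 4" and r: "0 < r"
    and low: "\<And>p \<beta>. (p, \<beta>) \<in> \<K> \<Longrightarrow> \<kappa> < norm (defect p \<beta>)"
    and near: "\<And>p \<beta> q \<gamma> h s x. (p, \<beta>) \<in> \<K> \<Longrightarrow> norm q = 1 \<Longrightarrow> q \<bullet> \<gamma> = 0 \<Longrightarrow>
       defect p \<beta> = norm (defect p \<beta>) *\<^sub>R q \<Longrightarrow> \<kappa> \<le> h \<Longrightarrow>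
       defect (p + s *\<^sub>R q) (\<beta> + s *\<^sub>R \<gamma>) = h *\<^sub>R q \<Longrightarrow>
       dist x (p + s *\<^sub>R q, \<beta> + s *\<^sub>R \<gamma>) < r \<Longrightarrow> x \<in> S_set \<delta>"
    by (rule S_set_perturbation[OF assms(1,3,4) \<eta>4]) (rule that)
  \<comment> \<open>Every \<open>\<rho> < 1\<close> is small enough.\<close>
  show ?thesis
  proof (intro exI[of _ "r / 4"] conjI allI impI ballI, simp add: r, clarify,
      intro exI[of _ "1::real"] conjI allI impI, simp)
    fix Q :: "(real ^ 'n) set" and I :: "real set" and p \<beta> :: "real ^ 'n" and \<rho> :: real
    assume Q: "open_box Q" and I: "open_box I" and pK: "(p, \<beta>) \<in> \<K>" and \<rho>: "0 < \<rho> \<and> \<rho> < 1"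
    obtain c d where Qcd: "Q = box c d" "box c d \<noteq> {}" using Q by (auto simp: open_box_def)
    obtain a b where ab: "I = box a b" "I \<noteq> {}" using I unfolding open_box_def by blast
    then have "a < b" by auto
    note Iab = ab(1) this
    have m: "measure lborel (Q \<times> I) > 0" by (rule box_pos[OF Q I])
    have pS: "(p, \<beta>) \<in> S_set \<delta>" using pK assms by auto
    obtain q \<gamma> s1 s2 k where q: "norm q = 1" "q \<bullet> \<gamma> = 0" and s: "s1 < 0" "0 < s2" and k: "0 < k"
      and dq: "defect p \<beta> = norm (defect p \<beta>) *\<^sub>R q"
      and seg: "\<And>s. defect (p + s *\<^sub>R q) (\<beta> + s *\<^sub>R \<gamma>) = (\<kappa> + k * ((s2 - s) * (s - s1))) *\<^sub>R q"
      by (rule S_set_segment[OF assms(1) pS \<kappa>(1) low[OF pK]]) (rule that)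
    \<comment> \<open>The first entry keeps the values in \<open>S\<^sub>\<delta>\<close>; the others, with \<open>\<kappa> \<le> \<eta>/4\<close>, make
      \<open>\<kappa> + 2 \<tau> + k \<tau>\<close> less than \<open>\<eta>\<close>.\<close>
    define \<tau> where "\<tau> = min (r / 8) (min (\<eta> / 16) (\<eta> / (8 * k)))"
    have \<tau>: "\<tau> > 0" "\<tau> \<le> r / 8" "\<tau> \<le> \<eta> / 16" "\<tau> \<le> \<eta> / (8 * k)"
      using r \<eta> k by (auto simp: \<tau>_def)
    have k\<tau>: "k * \<tau> \<le> \<eta> / 8" using \<tau>(4) k by (simp add: field_simps)
    have \<rho>2: "\<rho> / 2 > 0" using \<rho> by simp
    obtain \<phi> :: "(real ^ 'n) \<times> real \<Rightarrow> real" and \<psi> :: "(real ^ 'n) \<times> real \<Rightarrow> real ^ 'n"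
      and \<sigma> :: "(real ^ 'n) \<times> real \<Rightarrow> real"
      where sm: "smooth \<phi>" "smooth \<psi>" and supp: "(\<lambda>z. (\<phi> z, \<psi> z)) \<in> Cc_infty (box c d \<times> box a b)"
      and div: "\<And>z. div_x \<psi> z = 0" and mean: "\<And>t. (LINT x:box c d|lborel. \<phi> (x, t)) = 0"
      and size: "\<And>z. norm (\<phi> z, \<psi> z) \<le> \<rho> / 2" "\<And>z. \<bar>deriv_t \<phi> z\<bar> \<le> \<rho> / 2"
      and \<sigma>: "\<And>z. s1 \<le> \<sigma> z" "\<And>z. \<sigma> z \<le> s2"
      and close: "\<And>z. norm (grad_x \<phi> z - \<sigma> z *\<^sub>R q) \<le> \<tau>"
        "\<And>z. norm (deriv_t \<psi> z - \<sigma> z *\<^sub>R \<gamma>) \<le> \<tau>"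
      and int: "set_integrable lborel (box c d \<times> box a b) (\<lambda>z. (s2 - \<sigma> z) * (\<sigma> z - s1))"
      and intle: "(LINT z:(box c d \<times> box a b)|lborel. (s2 - \<sigma> z) * (\<sigma> z - s1))
        \<le> \<tau> * measure lborel (box c d \<times> box a b)"
      by (rule oscillation[OF q s Qcd(2) Iab(2) \<tau>(1) \<rho>2]) (rule that)
    have h: "\<kappa> \<le> \<kappa> + k * ((s2 - \<sigma> z) * (\<sigma> z - s1))" for z
      using k \<sigma>[of z] by simp
    show "\<exists>(\<phi> :: (real ^ 'n) \<times> real \<Rightarrow> real) (\<psi> :: (real ^ 'n) \<times> real \<Rightarrow> real ^ 'n).
        (\<lambda>z. (\<phi> z, \<psi> z)) \<in> Cc_infty (Q \<times> I) \<and>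
        (\<forall>z\<in>Q \<times> I. div_x \<psi> z = 0) \<and>
        (\<forall>z\<in>Q \<times> I. \<forall>p' \<beta>'. norm ((p', \<beta>') - (p, \<beta>)) \<le> r / 4 \<longrightarrow>
           (p' + grad_x \<phi> z, \<beta>' + deriv_t \<psi> z) \<in> S_set \<delta>) \<and>
        Linf_norm (Q \<times> I) (\<lambda>z. (\<phi> z, \<psi> z)) < ereal \<rho> \<and>
        (LINT z:(Q \<times> I)|lborel. norm (\<beta> + deriv_t \<psi> z - flux (p + grad_x \<phi> z)))
          < \<epsilon> * measure lborel (Q \<times> I) / measure lborel (Q' \<times> I') \<and>
        (\<forall>t\<in>I. (LINT x:Q|lborel. \<phi> (x, t)) = 0) \<and>
        Linf_norm (Q \<times> I) (deriv_t \<phi>) < ereal \<rho>"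
    proof (intro exI[of _ \<phi>] exI[of _ \<psi>] conjI ballI allI impI)
      show "(\<lambda>z. (\<phi> z, \<psi> z)) \<in> Cc_infty (Q \<times> I)" unfolding Qcd Iab by (rule supp)
      show "div_x \<psi> z = 0" for z by (rule div)
      show "(LINT x:Q|lborel. \<phi> (x, t)) = 0" for t unfolding Qcd by (rule mean)
      show "Linf_norm (Q \<times> I) (\<lambda>z. (\<phi> z, \<psi> z)) < ereal \<rho>"
        by (rule Linf_norm_less[where c="\<rho> / 2"]) (use size \<rho> sm in \<open>auto intro: smooth_continuous_on smooth_Pair\<close>)
      have "deriv_t \<phi> = dir_deriv (0, 1) \<phi>" by (rule ext) (rule deriv_t_eq_dir_deriv[OF sm(1)])
      then have "continuous_on UNIV (deriv_t \<phi>)" using smooth_continuous_on[OF smooth_dir_deriv[OF sm(1)]] by simp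
      then show "Linf_norm (Q \<times> I) (deriv_t \<phi>) < ereal \<rho>"
        by (rule Linf_norm_less[where c="\<rho> / 2"]) (use size \<rho> in auto)
    next
      fix z p' \<beta>'
      assume "norm ((p', \<beta>') - (p, \<beta>)) \<le> r / 4"
      have "dist (p' + grad_x \<phi> z, \<beta>' + deriv_t \<psi> z) (p + \<sigma> z *\<^sub>R q, \<beta> + \<sigma> z *\<^sub>R \<gamma>)
          = norm (((p', \<beta>') - (p, \<beta>)) + (grad_x \<phi> z - \<sigma> z *\<^sub>R q, deriv_t \<psi> z - \<sigma> z *\<^sub>R \<gamma>))"
        by (simp add: dist_norm algebra_simps)
      also have "\<dots> \<le> norm ((p', \<beta>') - (p, \<beta>)) + norm (grad_x \<phi> z - \<sigma> z *\<^sub>R q, deriv_t \<psi> z - \<sigma> z *\<^sub>R \<gamma>)"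
        by (rule norm_triangle_ineq)
      also have "\<dots> \<le> r / 4 + (\<tau> + \<tau>)"
        by (intro add_mono order_trans[OF norm_Pair_le] close) fact
      also have "\<dots> < r" using \<tau>(2) r by simp
      finally show "(p' + grad_x \<phi> z, \<beta>' + deriv_t \<psi> z) \<in> S_set \<delta>"
        by (rule near[OF pK q dq h seg])
    next
      have pt: "norm (\<beta> + deriv_t \<psi> z - flux (p + grad_x \<phi> z)) \<le> (\<kappa> + 2 * \<tau>) + k * ((s2 - \<sigma> z) * (\<sigma> z - s1))" for z
      proof -
        let ?P = "p + \<sigma> z *\<^sub>R q" and ?B = "\<beta> + \<sigma> z *\<^sub>R \<gamma>"
        have eq: "\<beta> + deriv_t \<psi> z - flux (p + grad_x \<phi> z)
            = (?B - flux ?P) + ((deriv_t \<psi> z - \<sigma> z *\<^sub>R \<gamma>) + (flux ?P - flux (p + grad_x \<phi> z)))" by simp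
        have "norm (?B - flux ?P) \<le> \<kappa> + k * ((s2 - \<sigma> z) * (\<sigma> z - s1))"
          using norm_flux_diff_le_defect[of ?B ?P] h[of z] \<kappa>(1) q(1) by (simp add: seg)
        moreover have "norm (flux ?P - flux (p + grad_x \<phi> z)) \<le> \<tau>"
          using flux_lipschitz[of ?P "p + grad_x \<phi> z"] close(1)[of z] by (simp add: norm_minus_commute)
        ultimately show ?thesis
          unfolding eq using norm_triangle_ineq[of "?B - flux ?P" "(deriv_t \<psi> z - \<sigma> z *\<^sub>R \<gamma>) + (flux ?P - flux (p + grad_x \<phi> z))"]
            norm_triangle_ineq[of "deriv_t \<psi> z - \<sigma> z *\<^sub>R \<gamma>" "flux ?P - flux (p + grad_x \<phi> z)"] close(2)[of z]
          by linarith
      qed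
      let ?\<Omega> = "box c d \<times> box a b"
      have fin: "emeasure lborel ?\<Omega> < \<infinity>" unfolding box_Pair_eq[symmetric] by (rule emeasure_lborel_box_finite)
      have sets: "?\<Omega> \<in> sets lborel" unfolding box_Pair_eq[symmetric] by simp
      have i1: "set_integrable lborel ?\<Omega> (\<lambda>z. \<kappa> + 2 * \<tau>)"
        unfolding box_Pair_eq[symmetric] by (intro set_integrable_box continuous_intros)
      have i2: "set_integrable lborel ?\<Omega> (\<lambda>z. k * ((s2 - \<sigma> z) * (\<sigma> z - s1)))"
        using int by (rule set_integrable_mult_right)
      have i3: "set_integrable lborel ?\<Omega> (\<lambda>z. (\<kappa> + 2 * \<tau>) + k * ((s2 - \<sigma> z) * (\<sigma> z - s1)))"
        by (rule set_integral_add(1)[OF i1 i2])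
      have "(LINT z:?\<Omega>|lborel. norm (\<beta> + deriv_t \<psi> z - flux (p + grad_x \<phi> z)))
          \<le> (LINT z:?\<Omega>|lborel. (\<kappa> + 2 * \<tau>) + k * ((s2 - \<sigma> z) * (\<sigma> z - s1)))"
        unfolding set_lebesgue_integral_def
      proof (rule integral_mono')
        show "integrable lborel (\<lambda>z. indicator ?\<Omega> z *\<^sub>R ((\<kappa> + 2 * \<tau>) + k * ((s2 - \<sigma> z) * (\<sigma> z - s1))))"
          using i3 by (simp add: set_integrable_def)
        show "indicator ?\<Omega> z *\<^sub>R norm (\<beta> + deriv_t \<psi> z - flux (p + grad_x \<phi> z))
          \<le> indicator ?\<Omega> z *\<^sub>R ((\<kappa> + 2 * \<tau>) + k * ((s2 - \<sigma> z) * (\<sigma> z - s1)))" for z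
          by (rule scaleR_left_mono[OF pt]) simp
        show "0 \<le> indicator ?\<Omega> z *\<^sub>R ((\<kappa> + 2 * \<tau>) + k * ((s2 - \<sigma> z) * (\<sigma> z - s1)))" for z
          using h[of z] \<kappa>(1) \<tau>(1) by (simp add: indicator_def)
      qed
      also have "\<dots> = (\<kappa> + 2 * \<tau>) * measure lborel ?\<Omega> + k * (LINT z:?\<Omega>|lborel. (s2 - \<sigma> z) * (\<sigma> z - s1))"
        unfolding set_integral_add(2)[OF i1 i2] set_integral_mult_right
        using sets fin by (simp add: set_lebesgue_integral_def mult.commute)
      also have "\<dots> \<le> (\<kappa> + 2 * \<tau>) * measure lborel ?\<Omega> + k * (\<tau> * measure lborel ?\<Omega>)"
        using intle k by simp
      also have "\<dots> = (\<kappa> + 2 * \<tau> + k * \<tau>) * measure lborel ?\<Omega>" by (simp add: algebra_simps)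
      also have "\<dots> < \<eta> * measure lborel ?\<Omega>"
        using m \<kappa>(2) \<tau>(3) k\<tau> \<eta> by (intro mult_strict_right_mono) (auto simp: Qcd(1) Iab(1))
      finally show "(LINT z:(Q \<times> I)|lborel. norm (\<beta> + deriv_t \<psi> z - flux (p + grad_x \<phi> z)))
          < \<epsilon> * measure lborel (Q \<times> I) / measure lborel (Q' \<times> I')"
        unfolding Qcd(1) Iab(1) by (simp add: \<eta>_def V_def)
    qed
  qed
qed

end
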